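(* Let $M$ be a smooth connected manifold of dimension $n\ge 2$. Let $S_0$ be an isotropic spray on $M$ with Jacobi endomorphism $\Phi_0$ and with non-vanishing Ricci scalar on $T_0M$. Then the projective class of $S_0$ contains at most one Finsler metrizable spray that has $\Phi_0$ as its Jacobi endomorphism.
   Context: Let $M$ be an $n$-dimensional smooth connected manifold, $TM$ its tangent bundle with induced coordinates $(x^i,y^i)$, and $T_0M=TM\setminus\{0\}$ the tangent bundle with the zero section removed. Let $\mathbb{C}=y^i\frac{\partial}{\partial y^i}$ be the Liouville vector field and $J=\frac{\partial}{\partial y^i}\otimes dx^i$ the tangent structure. "$k$-homogeneous" means positively homogeneous of degree $k$ in the fiber coordinates $y$. For a function $f$ on $T_0M$ and a vector valued $1$-form $L$, $d_Lf=df\circ L$; thus $d_Jf=\frac{\partial f}{\partial y^i}dx^i$. For a vector field $X$, $[X,L]$ denotes the Lie derivative of $L$ along $X$, i.e. $[X,L](Y)=[X,LY]-L[X,Y]$. Spray: a smooth vector field $S$ on $T_0M$ with $JS=\mathbb{C}$ and $[\mathbb{C},S]=S$; locally $S=y^i\frac{\partial}{\partial x^i}-2G^i(x,y)\frac{\partial}{\partial y^i}$ with $G^i$ $2$-homogeneous. Its horizontal projector is $h=\frac12(\mathrm{Id}-[S,J])$, and its Jacobi endomorphism (Riemann curvature) is the vector valued $1$-form $\Phi=(\mathrm{Id}-h)\circ[S,h]$. The projective class of $S_0$ is the set of all sprays $S=S_0-2P\mathbb{C}$ with $P$ a $1$-homogeneous smooth function on $T_0M$. A spray $S$ is isotropic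 if its Jacobi endomorphism has the form $\Phi=\rho J-\alpha\otimes\mathbb{C}$ for a function $\rho$ on $T_0M$ and a semi-basic $1$-form $\alpha$ (locally $\alpha=\alpha_i(x,y)dx^i$). The function $\rho$ is the Ricci scalar; it satisfies $(n-1)\rho=\operatorname{Tr}(\Phi)$ (the trace of the components $R^i_j$ in $\Phi=R^i_j\frac{\partial}{\partial y^i}\otimes dx^j$) and $i_S\alpha=\rho$. Finsler function: a continuous non-negative function $F:TM\to\mathbb{R}$ such that (i) $F$ is smooth on $T_0M$ and $F(x,y)=0$ if and only if $y=0$; (ii) $F$ is $1$-homogeneous; (iii) the $2$-form $dd_JF^2$ is symplectic on $T_0M$. The geodesic spray of $F$ is the spray $S$ satisfying $i_Sdd_JF^2=-dF^2$ (for a spray this is equivalent to $d_hF^2=0$). A spray is Finsler metrizable if it is the geodesic spray of some Finsler function. *)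

theory Defs
  imports "HOL-Analysis.Analysis"
begin

section \<open>Smooth maps between open subsets of Euclidean spaces\<close>

text \<open>
  Only meaningful on open sets \<open>S\<close>, which is the only way it is used.  Taking all iterated
  directional derivatives avoids a tower of types of higher derivatives.
\<close>
fun k_times_differentiable_on ::
    "nat \<Rightarrow> 'a::euclidean_space set \<Rightarrow> ('a \<Rightarrow> 'b::real_normed_vector) \<Rightarrow> bool" where
  "k_times_differentiable_on 0 S f \<longleftrightarrow> continuous_on S f"
| "k_times_differentiable_on (Suc k) S f \<longleftrightarrow>
     (\<forall>x\<in>S. f differentiable (at x)) \<and>
     (\<forall>v. k_times_differentiable_on k S (\<lambda>x. frechet_derivative f (at x) v))"

definition smooth_on :: "'a::euclidean_space set \<Rightarrow> ('a \<Rightarrow> 'b::real_normed_vector) \<Rightarrow> bool" where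
  "smooth_on S f \<longleftrightarrow> (\<forall>k. k_times_differentiable_on k S f)"


section \<open>Smooth manifolds\<close>

text \<open>
  A chart is a pair of its domain and its coordinate map; the values of the coordinate map
  outside the domain carry no information.
\<close>
type_synonym ('p, 'e) chart = "'p set \<times> ('p \<Rightarrow> 'e)"

definition chart_image :: "('p, 'e) chart \<Rightarrow> 'e set" where
  "chart_image c = snd c ` fst c"

definition chart_inv :: "('p, 'e) chart \<Rightarrow> 'e \<Rightarrow> 'p" where
  "chart_inv c = inv_into (fst c) (snd c)"

definition carrier_of :: "('p, 'e) chart set \<Rightarrow> 'p set" where
  "carrier_of A = (\<Union>c\<in>A. fst c)"

definition charts_at :: "('p, 'e) chart set \<Rightarrow> 'p \<Rightarrow> ('p, 'e) chart set" where
  "charts_at A p = {c \<in> A. p \<in> fst c}"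

definition smooth_manifold :: "'p topology \<Rightarrow> ('p, 'e::euclidean_space) chart set \<Rightarrow> bool" where
  "smooth_manifold X A \<longleftrightarrow>
     Hausdorff_space X \<and> second_countable X \<and> carrier_of A = topspace X \<and>
     (\<forall>c\<in>A. openin X (fst c) \<and> open (chart_image c) \<and>
        homeomorphic_map (subtopology X (fst c)) (top_of_set (chart_image c)) (snd c)) \<and>
     (\<forall>c\<in>A. \<forall>d\<in>A. smooth_on (snd c ` (fst c \<inter> fst d)) (snd d \<circ> chart_inv c))"


section \<open>Tangent vectors, vector fields and forms\<close>

text \<open>
  All notions of this section are relative to a smooth atlas \<open>A\<close> and will be used both for the
  atlas of \<open>M\<close> and for the induced atlas of the slit tangent bundle.

  A tangent vector at \<open>p\<close> is the family of its components in all charts around \<open>p\<close>, subject to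
  the usual transformation rule.  The components are set to zero in all other charts, so that
  equality of tangent vectors is equality of functions.
\<close>
type_synonym ('p, 'e) tvec = "('p, 'e) chart \<Rightarrow> 'e"

definition transition_deriv ::
    "('p, 'e::euclidean_space) chart \<Rightarrow> ('p, 'e) chart \<Rightarrow> 'p \<Rightarrow> 'e \<Rightarrow> 'e" where
  "transition_deriv c d p = frechet_derivative (snd d \<circ> chart_inv c) (at (snd c p))"

definition tangent_space ::
    "('p, 'e::euclidean_space) chart set \<Rightarrow> 'p \<Rightarrow> ('p, 'e) tvec set" where
  "tangent_space A p =
     {v. (\<forall>c\<in>charts_at A p. \<forall>d\<in>charts_at A p. v d = transition_deriv c d p (v c)) \<and>
         (\<forall>c. c \<notin> charts_at A p \<longrightarrow> v c = 0)}"

definition coord_vector ::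
    "('p, 'e::euclidean_space) chart set \<Rightarrow> ('p, 'e) chart \<Rightarrow> 'p \<Rightarrow> 'e \<Rightarrow> ('p, 'e) tvec" where
  "coord_vector A c p e = (\<lambda>d. if d \<in> charts_at A p then transition_deriv c d p e else 0)"

definition smooth_fun :: "('p, 'e::euclidean_space) chart set \<Rightarrow> ('p \<Rightarrow> real) \<Rightarrow> bool" where
  "smooth_fun A f \<longleftrightarrow> (\<forall>c\<in>A. smooth_on (chart_image c) (f \<circ> chart_inv c))"

definition smooth_vector_field ::
    "('p, 'e::euclidean_space) chart set \<Rightarrow> ('p \<Rightarrow> ('p, 'e) tvec) \<Rightarrow> bool" where
  "smooth_vector_field A X \<longleftrightarrow>
     (\<forall>p\<in>carrier_of A. X p \<in> tangent_space A p) \<and>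
     (\<forall>c\<in>A. smooth_on (chart_image c) (\<lambda>z. X (chart_inv c z) c))"

text \<open>In each chart: \<open>[X, Y]\<^sup>i = X\<^sup>j \<partial>\<^sub>j Y\<^sup>i - Y\<^sup>j \<partial>\<^sub>j X\<^sup>i\<close>.\<close>
definition lie_bracket ::
    "('p, 'e::euclidean_space) chart set \<Rightarrow> ('p \<Rightarrow> ('p, 'e) tvec) \<Rightarrow> ('p \<Rightarrow> ('p, 'e) tvec) \<Rightarrow>
     'p \<Rightarrow> ('p, 'e) tvec" where
  "lie_bracket A X Y p = (\<lambda>c.
     if c \<in> charts_at A p then
       frechet_derivative (\<lambda>z. Y (chart_inv c z) c) (at (snd c p)) (X p c) -
       frechet_derivative (\<lambda>z. X (chart_inv c z) c) (at (snd c p)) (Y p c)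
     else 0)"

text \<open>
  A vector valued 1-form \<open>L\<close> assigns to each point \<open>p\<close> an endomorphism of the tangent space at
  \<open>p\<close>.  Its Lie derivative \<open>[X, L](Y) = [X, L Y] - L [X, Y]\<close> is tensorial in \<open>Y\<close>; it is
  evaluated on a vector \<open>v\<close> at \<open>p\<close> by taking for \<open>Y\<close> a local extension of \<open>v\<close>, namely, for the
  component in the chart \<open>c\<close>, the one whose components with respect to \<open>c\<close> are constant.
\<close>
definition lie_derivative_endo ::
    "('p, 'e::euclidean_space) chart set \<Rightarrow> ('p \<Rightarrow> ('p, 'e) tvec) \<Rightarrow>
     ('p \<Rightarrow> ('p, 'e) tvec \<Rightarrow> ('p, 'e) tvec) \<Rightarrow> 'p \<Rightarrow> ('p, 'e) tvec \<Rightarrow> ('p, 'e) tvec" where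
  "lie_derivative_endo A X L p v = (\<lambda>c.
     if c \<in> charts_at A p then
       (let Y = (\<lambda>q. coord_vector A c q (v c)) in
          lie_bracket A X (\<lambda>q. L q (Y q)) p c - L p (lie_bracket A X Y p) c)
     else 0)"

text \<open>
  Differentials and exterior derivatives do not depend on the chart used to compute them, so an
  arbitrary chart around the point is chosen.
\<close>
definition chart_at :: "('p, 'e) chart set \<Rightarrow> 'p \<Rightarrow> ('p, 'e) chart" where
  "chart_at A p = (SOME c. c \<in> charts_at A p)"

definition differential ::
    "('p, 'e::euclidean_space) chart set \<Rightarrow> ('p \<Rightarrow> real) \<Rightarrow> 'p \<Rightarrow> ('p, 'e) tvec \<Rightarrow> real" where
  "differential A f p v =
     (let c = chart_at A p in frechet_derivative (f \<circ> chart_inv c) (at (snd c p)) (v c))"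

definition differential_along ::
    "('p, 'e::euclidean_space) chart set \<Rightarrow> ('p \<Rightarrow> ('p, 'e) tvec \<Rightarrow> ('p, 'e) tvec) \<Rightarrow>
     ('p \<Rightarrow> real) \<Rightarrow> 'p \<Rightarrow> ('p, 'e) tvec \<Rightarrow> real" where
  "differential_along A L f p v = differential A f p (L p v)"

definition smooth_one_form ::
    "('p, 'e::euclidean_space) chart set \<Rightarrow> ('p \<Rightarrow> ('p, 'e) tvec \<Rightarrow> real) \<Rightarrow> bool" where
  "smooth_one_form A \<omega> \<longleftrightarrow>
     (\<forall>p\<in>carrier_of A. \<forall>v\<in>tangent_space A p. \<forall>w\<in>tangent_space A p. \<forall>a b.
        \<omega> p (\<lambda>c. a *\<^sub>R v c + b *\<^sub>R w c) = a * \<omega> p v + b * \<omega> p w) \<and>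
     (\<forall>c\<in>A. \<forall>e. smooth_on (chart_image c)
        (\<lambda>z. \<omega> (chart_inv c z) (coord_vector A c (chart_inv c z) e)))"

definition smooth_two_form ::
    "('p, 'e::euclidean_space) chart set \<Rightarrow> ('p \<Rightarrow> ('p, 'e) tvec \<Rightarrow> ('p, 'e) tvec \<Rightarrow> real) \<Rightarrow> bool"
  where
  "smooth_two_form A \<Omega> \<longleftrightarrow>
     (\<forall>p\<in>carrier_of A. \<forall>u\<in>tangent_space A p.
        \<Omega> p u u = 0 \<and>
        (\<forall>v\<in>tangent_space A p. \<forall>w\<in>tangent_space A p. \<forall>a b.
           \<Omega> p (\<lambda>c. a *\<^sub>R v c + b *\<^sub>R w c) u = a * \<Omega> p v u + b * \<Omega> p w u \<and>
           \<Omega> p u (\<lambda>c. a *\<^sub>R v c + b *\<^sub>R w c) = a * \<Omega> p u v + b * \<Omega> p u w)) \<and>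
     (\<forall>c\<in>A. \<forall>e e'. smooth_on (chart_image c)
        (\<lambda>z. \<Omega> (chart_inv c z) (coord_vector A c (chart_inv c z) e)
                               (coord_vector A c (chart_inv c z) e')))"

text \<open>
  The invariant formulas for the exterior derivative, e.g.
  \<open>d\<omega>(V, W) = V(\<omega>(W)) - W(\<omega>(V)) - \<omega>([V, W])\<close>, evaluated on vector fields with constant
  components in one chart, for which the terms with brackets vanish.
\<close>
definition ext_deriv_one_form ::
    "('p, 'e::euclidean_space) chart set \<Rightarrow> ('p \<Rightarrow> ('p, 'e) tvec \<Rightarrow> real) \<Rightarrow>
     'p \<Rightarrow> ('p, 'e) tvec \<Rightarrow> ('p, 'e) tvec \<Rightarrow> real" where
  "ext_deriv_one_form A \<omega> p v w =
     (let c = chart_at A p;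
          \<omega>\<^sub>c = (\<lambda>e z. \<omega> (chart_inv c z) (coord_vector A c (chart_inv c z) e))
      in frechet_derivative (\<omega>\<^sub>c (w c)) (at (snd c p)) (v c) -
         frechet_derivative (\<omega>\<^sub>c (v c)) (at (snd c p)) (w c))"

definition ext_deriv_two_form ::
    "('p, 'e::euclidean_space) chart set \<Rightarrow> ('p \<Rightarrow> ('p, 'e) tvec \<Rightarrow> ('p, 'e) tvec \<Rightarrow> real) \<Rightarrow>
     'p \<Rightarrow> ('p, 'e) tvec \<Rightarrow> ('p, 'e) tvec \<Rightarrow> ('p, 'e) tvec \<Rightarrow> real" where
  "ext_deriv_two_form A \<Omega> p u v w =
     (let c = chart_at A p;
          \<Omega>\<^sub>c = (\<lambda>e e' z. \<Omega> (chart_inv c z) (coord_vector A c (chart_inv c z) e)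
                                            (coord_vector A c (chart_inv c z) e'))
      in frechet_derivative (\<Omega>\<^sub>c (v c) (w c)) (at (snd c p)) (u c) -
         frechet_derivative (\<Omega>\<^sub>c (u c) (w c)) (at (snd c p)) (v c) +
         frechet_derivative (\<Omega>\<^sub>c (u c) (v c)) (at (snd c p)) (w c))"

definition symplectic_form ::
    "('p, 'e::euclidean_space) chart set \<Rightarrow> ('p \<Rightarrow> ('p, 'e) tvec \<Rightarrow> ('p, 'e) tvec \<Rightarrow> real) \<Rightarrow> bool"
  where
  "symplectic_form A \<Omega> \<longleftrightarrow>
     smooth_two_form A \<Omega> \<and>
     (\<forall>p\<in>carrier_of A. \<forall>u\<in>tangent_space A p. \<forall>v\<in>tangent_space A p. \<forall>w\<in>tangent_space A p.
        ext_deriv_two_form A \<Omega> p u v w = 0) \<and>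
     (\<forall>p\<in>carrier_of A. \<forall>v\<in>tangent_space A p.
        (\<forall>w\<in>tangent_space A p. \<Omega> p v w = 0) \<longrightarrow> v = (\<lambda>_. 0))"


section \<open>The tangent bundle and the slit tangent bundle\<close>

type_synonym ('p, 'e) tpoint = "'p \<times> ('p, 'e) tvec"

definition tangent_bundle :: "('p, 'e::euclidean_space) chart set \<Rightarrow> ('p, 'e) tpoint set" where
  "tangent_bundle A = (SIGMA p:carrier_of A. tangent_space A p)"

definition slit_bundle :: "('p, 'e::euclidean_space) chart set \<Rightarrow> ('p, 'e) tpoint set" where
  "slit_bundle A = {(p, v) \<in> tangent_bundle A. v \<noteq> (\<lambda>_. 0)}"

text \<open>The induced coordinates \<open>(x, y)\<close>.\<close>
definition tangent_chart ::
    "('p, 'e::euclidean_space) chart set \<Rightarrow> ('p, 'e) chart \<Rightarrow> (('p, 'e) tpoint, 'e \<times> 'e) chart"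
  where
  "tangent_chart A c =
     ({(p, v) \<in> tangent_bundle A. p \<in> fst c}, (\<lambda>(p, v). (snd c p, v c)))"

definition tangent_atlas ::
    "('p, 'e::euclidean_space) chart set \<Rightarrow> (('p, 'e) tpoint, 'e \<times> 'e) chart set" where
  "tangent_atlas A = tangent_chart A ` A"

definition slit_atlas ::
    "('p, 'e::euclidean_space) chart set \<Rightarrow> (('p, 'e) tpoint, 'e \<times> 'e) chart set" where
  "slit_atlas A = (\<lambda>c. (fst (tangent_chart A c) \<inter> slit_bundle A, snd (tangent_chart A c))) ` A"

definition scale_fibre :: "real \<Rightarrow> ('p, 'e::euclidean_space) tpoint \<Rightarrow> ('p, 'e) tpoint" where
  "scale_fibre r u = (fst u, \<lambda>c. r *\<^sub>R snd u c)"

definition one_homogeneous_on ::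
    "('p, 'e::euclidean_space) tpoint set \<Rightarrow> (('p, 'e) tpoint \<Rightarrow> real) \<Rightarrow> bool" where
  "one_homogeneous_on N f \<longleftrightarrow> (\<forall>u\<in>N. \<forall>r>0. f (scale_fibre r u) = r * f u)"

text \<open>
  Vectors tangent to the slit tangent bundle: in induced coordinates their components are pairs,
  the components along \<open>\<partial>/\<partial>x\<close> and along \<open>\<partial>/\<partial>y\<close>.
\<close>
type_synonym ('p, 'e) ttvec = "(('p, 'e) tpoint, 'e \<times> 'e) tvec"

definition liouville ::
    "('p, 'e::euclidean_space) chart set \<Rightarrow> ('p, 'e) tpoint \<Rightarrow> ('p, 'e) ttvec" where
  "liouville A u = (\<lambda>c. if c \<in> charts_at (slit_atlas A) u then (0, snd (snd c u)) else 0)"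

definition tangent_structure ::
    "('p, 'e::euclidean_space) chart set \<Rightarrow> ('p, 'e) tpoint \<Rightarrow> ('p, 'e) ttvec \<Rightarrow> ('p, 'e) ttvec"
  where
  "tangent_structure A u w =
     (\<lambda>c. if c \<in> charts_at (slit_atlas A) u then (0, fst (w c)) else 0)"

definition semi_basic ::
    "('p, 'e::euclidean_space) chart set \<Rightarrow> (('p, 'e) tpoint \<Rightarrow> ('p, 'e) ttvec \<Rightarrow> real) \<Rightarrow> bool"
  where
  "semi_basic A \<alpha> \<longleftrightarrow>
     (\<forall>u\<in>slit_bundle A. \<forall>w\<in>tangent_space (slit_atlas A) u.
        (\<forall>c\<in>charts_at (slit_atlas A) u. fst (w c) = 0) \<longrightarrow> \<alpha> u w = 0)"


section \<open>Sprays\<close>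

definition spray ::
    "('p, 'e::euclidean_space) chart set \<Rightarrow> (('p, 'e) tpoint \<Rightarrow> ('p, 'e) ttvec) \<Rightarrow> bool" where
  "spray A S \<longleftrightarrow>
     smooth_vector_field (slit_atlas A) S \<and>
     (\<forall>u\<in>slit_bundle A. tangent_structure A u (S u) = liouville A u) \<and>
     (\<forall>u\<in>slit_bundle A. lie_bracket (slit_atlas A) (liouville A) S u = S u)"

definition horizontal_projector ::
    "('p, 'e::euclidean_space) chart set \<Rightarrow> (('p, 'e) tpoint \<Rightarrow> ('p, 'e) ttvec) \<Rightarrow>
     ('p, 'e) tpoint \<Rightarrow> ('p, 'e) ttvec \<Rightarrow> ('p, 'e) ttvec" where
  "horizontal_projector A S u w =
     (\<lambda>c. (1/2) *\<^sub>R (w c - lie_derivative_endo (slit_atlas A) S (tangent_structure A) u w c))"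

definition jacobi_endomorphism ::
    "('p, 'e::euclidean_space) chart set \<Rightarrow> (('p, 'e) tpoint \<Rightarrow> ('p, 'e) ttvec) \<Rightarrow>
     ('p, 'e) tpoint \<Rightarrow> ('p, 'e) ttvec \<Rightarrow> ('p, 'e) ttvec" where
  "jacobi_endomorphism A S u w =
     (let w' = lie_derivative_endo (slit_atlas A) S (horizontal_projector A S) u w
      in (\<lambda>c. w' c - horizontal_projector A S u w' c))"

definition projective_class ::
    "('p, 'e::euclidean_space) chart set \<Rightarrow> (('p, 'e) tpoint \<Rightarrow> ('p, 'e) ttvec) \<Rightarrow>
     (('p, 'e) tpoint \<Rightarrow> ('p, 'e) ttvec) set" where
  "projective_class A S\<^sub>0 =
     {S. spray A S \<and>
         (\<exists>P. smooth_fun (slit_atlas A) P \<and> one_homogeneous_on (slit_bundle A) P \<and>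
              (\<forall>u\<in>slit_bundle A. S u = (\<lambda>c. S\<^sub>0 u c - (2 * P u) *\<^sub>R liouville A u c)))}"

text \<open>
  The function \<open>\<rho>\<close> is the Ricci scalar of \<open>S\<close>.  In dimension at least two it is determined by
  the Jacobi endomorphism, and so is \<open>\<alpha>\<close>.
\<close>
definition isotropic_spray ::
    "('p, 'e::euclidean_space) chart set \<Rightarrow> (('p, 'e) tpoint \<Rightarrow> ('p, 'e) ttvec) \<Rightarrow>
     (('p, 'e) tpoint \<Rightarrow> real) \<Rightarrow> (('p, 'e) tpoint \<Rightarrow> ('p, 'e) ttvec \<Rightarrow> real) \<Rightarrow> bool" where
  "isotropic_spray A S \<rho> \<alpha> \<longleftrightarrow>
     spray A S \<and> smooth_fun (slit_atlas A) \<rho> \<and>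
     smooth_one_form (slit_atlas A) \<alpha> \<and> semi_basic A \<alpha> \<and>
     (\<forall>u\<in>slit_bundle A. \<forall>w\<in>tangent_space (slit_atlas A) u.
        jacobi_endomorphism A S u w =
          (\<lambda>c. \<rho> u *\<^sub>R tangent_structure A u w c - \<alpha> u w *\<^sub>R liouville A u c))"


section \<open>Finsler functions\<close>

definition ddJ ::
    "('p, 'e::euclidean_space) chart set \<Rightarrow> (('p, 'e) tpoint \<Rightarrow> real) \<Rightarrow>
     ('p, 'e) tpoint \<Rightarrow> ('p, 'e) ttvec \<Rightarrow> ('p, 'e) ttvec \<Rightarrow> real" where
  "ddJ A f = ext_deriv_one_form (slit_atlas A)
     (differential_along (slit_atlas A) (tangent_structure A) f)"

text \<open>
  The topology of the tangent bundle is the one for which the induced charts are homeomorphisms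
  onto open sets, so continuity is continuity in induced coordinates.
\<close>
definition finsler_function ::
    "('p, 'e::euclidean_space) chart set \<Rightarrow> (('p, 'e) tpoint \<Rightarrow> real) \<Rightarrow> bool" where
  "finsler_function A F \<longleftrightarrow>
     (\<forall>c\<in>tangent_atlas A. continuous_on (chart_image c) (F \<circ> chart_inv c)) \<and>
     (\<forall>u\<in>tangent_bundle A. 0 \<le> F u) \<and>
     smooth_fun (slit_atlas A) F \<and>
     (\<forall>u\<in>tangent_bundle A. F u = 0 \<longleftrightarrow> snd u = (\<lambda>_. 0)) \<and>
     one_homogeneous_on (tangent_bundle A) F \<and>
     symplectic_form (slit_atlas A) (ddJ A (\<lambda>u. (F u)\<^sup>2))"

definition geodesic_spray ::
    "('p, 'e::euclidean_space) chart set \<Rightarrow> (('p, 'e) tpoint \<Rightarrow> real) \<Rightarrow>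
     (('p, 'e) tpoint \<Rightarrow> ('p, 'e) ttvec) \<Rightarrow> bool" where
  "geodesic_spray A F S \<longleftrightarrow>
     spray A S \<and>
     (\<forall>u\<in>slit_bundle A. \<forall>w\<in>tangent_space (slit_atlas A) u.
        ddJ A (\<lambda>u. (F u)\<^sup>2) u (S u) w = - differential (slit_atlas A) (\<lambda>u. (F u)\<^sup>2) u w)"

definition finsler_metrizable ::
    "('p, 'e::euclidean_space) chart set \<Rightarrow> (('p, 'e) tpoint \<Rightarrow> ('p, 'e) ttvec) \<Rightarrow> bool" where
  "finsler_metrizable A S \<longleftrightarrow> (\<exists>F. finsler_function A F \<and> geodesic_spray A F S)"

end

theory Submission
  imports Defs
begin

text \<open>
  Let \<open>E = F\<^sup>2\<close> for a Finsler function \<open>F\<close> with geodesic spray \<open>S\<close>. Then \<open>S\<close> and all horizontal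
  vector fields annihilate \<open>E\<close>, hence so do their brackets, and \<open>d\<^sub>\<Phi> E = 0\<close>. For \<open>\<Phi> = \<rho> J - \<alpha> \<otimes> C\<close> this
  says \<open>\<rho> d\<^sub>J E = 2 E \<alpha>\<close>, so that \<open>\<rho>\<close> and \<open>\<alpha>\<close> determine \<open>d\<^sub>J ln E\<close>.

  For two metrizable sprays with the same \<open>\<Phi>\<close>, \<open>S\<^sub>2 = S\<^sub>1 - 2 P C\<close>, the quotient \<open>q = E\<^sub>2 / E\<^sub>1\<close> is
  therefore constant on the fibres, and \<open>d\<^sub>h E\<^sub>2 = 0\<close> becomes
  \<open>\<partial>q/\<partial>x\<^sup>i = q (2 \<partial>P/\<partial>y\<^sup>i + P \<partial>(ln E\<^sub>1)/\<partial>y\<^sup>i)\<close>. Contraction with \<open>y\<^sup>i\<close> gives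
  \<open>4 q P = y\<^sup>i \<partial>q/\<partial>x\<^sup>i\<close>, so \<open>P\<close> is linear on each fibre; inserting this again shows that \<open>P\<^sup>2 / E\<^sub>1\<close> is
  constant on each fibre. Since a linear form in dimension at least two has a nontrivial kernel,
  \<open>P = 0\<close>.
\<close>

section \<open>Derivatives of smooth maps\<close>

abbreviation fderiv :: "('a::real_normed_vector \<Rightarrow> 'b::real_normed_vector) \<Rightarrow> 'a \<Rightarrow> 'a \<Rightarrow> 'b" where
  "fderiv f x \<equiv> frechet_derivative f (at x)"

abbreviation fderiv2 :: "('a::real_normed_vector \<Rightarrow> 'b::real_normed_vector) \<Rightarrow> 'a \<Rightarrow> 'a \<Rightarrow> 'a \<Rightarrow> 'b"
  where "fderiv2 f x v w \<equiv> fderiv (\<lambda>x. fderiv f x v) x w"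

lemma fderiv_eq: "(f has_derivative f') (at x) \<Longrightarrow> fderiv f x = f'"
  by (rule frechet_derivative_at[symmetric])

lemma has_fderiv: "f differentiable at x \<Longrightarrow> (f has_derivative fderiv f x) (at x)"
  by (simp add: frechet_derivative_works)

text \<open>The choice behind \<open>frechet_derivative\<close> depends only on which maps are
  derivatives at \<open>x\<close>, and that is a local matter. So the values agree even at points
  where neither map is differentiable.\<close>

lemma fderiv_cong_open:
  assumes "open W" "x \<in> W" "\<And>y. y \<in> W \<Longrightarrow> f y = g y"
  shows "fderiv f x = fderiv g x"
proof -
  have "(f has_derivative D) (at x) \<longleftrightarrow> (g has_derivative D) (at x)" for D
    using assms has_derivative_transform_within_open[of f D x UNIV W g]
      has_derivative_transform_within_open[of g D x UNIV W f] by auto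
  then show ?thesis
    by (simp add: frechet_derivative_def)
qed

lemma differentiable_cong_open:
  assumes "open W" "x \<in> W" "\<And>y. y \<in> W \<Longrightarrow> f y = g y" "f differentiable at x"
  shows "g differentiable at x"
  using assms has_derivative_transform_within_open[of f _ x UNIV W g]
  by (auto simp: differentiable_def)

lemma fderiv_linear:
  assumes "f differentiable at x"
  shows "fderiv f x (v + w) = fderiv f x v + fderiv f x w"
    and "fderiv f x (v - w) = fderiv f x v - fderiv f x w"
    and "fderiv f x (r *\<^sub>R v) = r *\<^sub>R fderiv f x v"
    and "fderiv f x (- v) = - fderiv f x v"
    and "fderiv f x 0 = 0"
  using linear_frechet_derivative[OF assms]
  by (simp_all add: linear_add linear_diff linear_cmul linear_neg linear_0)

section \<open>Closure properties of smooth maps\<close>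

lemma smooth_on_differentiable: "smooth_on W f \<Longrightarrow> x \<in> W \<Longrightarrow> f differentiable at x"
  unfolding smooth_on_def using k_times_differentiable_on.simps(2)[of 0 W f] by blast

lemma smooth_on_fderiv: "smooth_on W f \<Longrightarrow> smooth_on W (\<lambda>x. fderiv f x v)"
  unfolding smooth_on_def using k_times_differentiable_on.simps(2)[of _ W f] by blast

lemma smooth_on_continuous: "smooth_on W f \<Longrightarrow> continuous_on W f"
  unfolding smooth_on_def using k_times_differentiable_on.simps(1) by blast

lemma k_times_differentiable_on_cong:
  assumes "open W" "\<And>x. x \<in> W \<Longrightarrow> f x = g x" "k_times_differentiable_on k W f"
  shows "k_times_differentiable_on k W g"
  using assms(2,3)
proof (induction k arbitrary: f g)
  case 0
  then show ?case
    by (metis continuous_on_cong k_times_differentiable_on.simps(1))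
next
  case (Suc k)
  have "g differentiable at x" if "x \<in> W" for x
    using differentiable_cong_open[OF assms(1) that Suc.prems(1)] Suc.prems(2) that by simp
  moreover have "k_times_differentiable_on k W (\<lambda>x. fderiv g x v)" for v
    by (rule Suc.IH[of "\<lambda>x. fderiv f x v"])
      (use Suc.prems fderiv_cong_open[OF assms(1) _ Suc.prems(1)] in auto)
  ultimately show ?case
    by simp
qed

lemma k_times_differentiable_on_Suc_imp:
  "k_times_differentiable_on (Suc k) W f \<Longrightarrow> k_times_differentiable_on k W f"
proof (induction k arbitrary: f)
  case 0
  then show ?case
    by (auto intro!: continuous_at_imp_continuous_on differentiable_imp_continuous_within)
next
  case (Suc k)
  then have "k_times_differentiable_on k W (\<lambda>x. fderiv f x v)" for v
    using k_times_differentiable_on.simps(2)[of "Suc k" W f] by blast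
  then show ?case
    using Suc.prems k_times_differentiable_on.simps(2)[of _ W f] by blast
qed

lemma k_times_differentiable_on_add:
  assumes "open W" "k_times_differentiable_on k W f" "k_times_differentiable_on k W g"
  shows "k_times_differentiable_on k W (\<lambda>x. f x + g x)"
  using assms(2,3)
proof (induction k arbitrary: f g)
  case 0
  then show ?case
    by (simp add: continuous_on_add)
next
  case (Suc k)
  have eq: "fderiv (\<lambda>x. f x + g x) x v = fderiv f x v + fderiv g x v" if "x \<in> W" for x v
    by (subst fderiv_eq[OF has_derivative_add[OF has_fderiv has_fderiv]])
      (use Suc.prems that in auto)
  have "k_times_differentiable_on k W (\<lambda>x. fderiv (\<lambda>x. f x + g x) x v)" for v
    by (rule k_times_differentiable_on_cong[OF assms(1) _ Suc.IH
            [of "\<lambda>x. fderiv f x v" "\<lambda>x. fderiv g x v"]])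
      (use Suc.prems eq in auto)
  then show ?case
    using Suc.prems by (simp add: differentiable_add)
qed

lemma k_times_differentiable_on_mult:
  fixes f g :: "'a::euclidean_space \<Rightarrow> 'b::real_normed_algebra"
  assumes "open W" "k_times_differentiable_on k W f" "k_times_differentiable_on k W g"
  shows "k_times_differentiable_on k W (\<lambda>x. f x * g x)"
  using assms(2,3)
proof (induction k arbitrary: f g)
  case 0
  then show ?case
    by (simp add: continuous_on_mult)
next
  case (Suc k)
  have eq: "fderiv (\<lambda>x. f x * g x) x v = f x * fderiv g x v + fderiv f x v * g x"
    if "x \<in> W" for x v
    by (subst fderiv_eq[OF has_derivative_mult[OF has_fderiv has_fderiv]])
      (use Suc.prems that in auto)
  \<comment> \<open>The product rule contains \<open>f\<close> and \<open>g\<close> themselves, so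
    these are needed at order \<open>k\<close> next to their derivatives.\<close>
  have "k_times_differentiable_on k W f" "k_times_differentiable_on k W g"
    using Suc.prems k_times_differentiable_on_Suc_imp by blast+
  then have "k_times_differentiable_on k W (\<lambda>x. f x * fderiv g x v + fderiv f x v * g x)" for v
    by (intro k_times_differentiable_on_add assms(1) Suc.IH) (use Suc.prems in auto)
  then have "k_times_differentiable_on k W (\<lambda>x. fderiv (\<lambda>x. f x * g x) x v)" for v
    by (rule k_times_differentiable_on_cong[OF assms(1), rotated]) (simp add: eq)
  then show ?case
    using Suc.prems by (simp add: differentiable_mult)
qed

lemma smooth_on_power2:
  fixes f :: "'a::euclidean_space \<Rightarrow> real"
  shows "open W \<Longrightarrow> smooth_on W f \<Longrightarrow> smooth_on W (\<lambda>x. (f x)\<^sup>2)"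
  unfolding smooth_on_def power2_eq_square by (blast intro: k_times_differentiable_on_mult)

text \<open>Smoothness controls \<open>fderiv f x v\<close> as a function of \<open>x\<close> for a
  fixed direction \<open>v\<close> only. Expanding the moving direction in the basis leaves finitely
  many fixed directions, to which the chain rule and the product rule apply.\<close>

lemma has_derivative_fderiv_apply:
  fixes f :: "'a::euclidean_space \<Rightarrow> 'b::real_normed_vector" and s :: "'c::real_normed_vector \<Rightarrow> 'a"
  assumes W: "open W" "p z \<in> W" and f: "smooth_on W f"
    and p: "(p has_derivative p') (at z)" and s: "(s has_derivative s') (at z)"
  shows "((\<lambda>x. fderiv f (p x) (s x)) has_derivative
           (\<lambda>w. fderiv2 f (p z) (s z) (p' w) + fderiv f (p z) (s' w))) (at z)"
proof -
  have exp: "fderiv f x v = (\<Sum>b\<in>Basis. (v \<bullet> b) *\<^sub>R fderiv f x b)" if "x \<in> W" for x v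
  proof -
    have l: "linear (fderiv f x)"
      using smooth_on_differentiable[OF f that] by (rule linear_frechet_derivative)
    have "fderiv f x (\<Sum>b\<in>Basis. (v \<bullet> b) *\<^sub>R b) = (\<Sum>b\<in>Basis. (v \<bullet> b) *\<^sub>R fderiv f x b)"
      by (simp add: linear_sum[OF l] linear_cmul[OF l])
    then show ?thesis
      by (simp add: euclidean_representation)
  qed
  have dfb: "((\<lambda>x. fderiv f x b) has_derivative fderiv2 f y b) (at y)" if "y \<in> W" for b y
    using smooth_on_differentiable[OF smooth_on_fderiv[OF f] that] by (rule has_fderiv)
  \<comment> \<open>Linearity of the second derivative in its first direction, obtained by
    differentiating \<open>exp\<close>; it folds the basis sums back at the end.\<close>
  have exp2: "fderiv2 f (p z) v w = (\<Sum>b\<in>Basis. (v \<bullet> b) *\<^sub>R fderiv2 f (p z) b w)" for v w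
  proof -
    have "((\<lambda>x. fderiv f x v) has_derivative (\<lambda>w. \<Sum>b\<in>Basis. (v \<bullet> b) *\<^sub>R fderiv2 f (p z) b w)) (at (p z))"
      by (rule has_derivative_transform_within_open[OF _ W exp[symmetric]])
        (intro has_derivative_sum has_derivative_scaleR_right dfb[OF W(2)])
    then show ?thesis
      by (simp add: fderiv_eq)
  qed
  have "isCont p z"
    using p has_derivative_continuous by blast
  \<comment> \<open>The expansion in the basis is valid only where \<open>p x\<close> lies in
    \<open>W\<close>, which continuity of \<open>p\<close> ensures near \<open>z\<close>.\<close>
  then obtain U where U: "open U" "z \<in> U" "\<And>x. x \<in> U \<Longrightarrow> p x \<in> W"
    by (metis W continuous_at_open)
  have c: "((\<lambda>x. fderiv f (p x) b) has_derivative (\<lambda>w. fderiv2 f (p z) b (p' w))) (at z)" for b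
    by (rule has_derivative_compose[OF p dfb[OF W(2)]])
  have "((\<lambda>x. \<Sum>b\<in>Basis. (s x \<bullet> b) *\<^sub>R fderiv f (p x) b) has_derivative
     (\<lambda>w. \<Sum>b\<in>Basis. (s z \<bullet> b) *\<^sub>R fderiv2 f (p z) b (p' w) + (s' w \<bullet> b) *\<^sub>R fderiv f (p z) b)) (at z)"
    by (intro has_derivative_sum has_derivative_scaleR has_derivative_inner_left c s)
  then have "((\<lambda>x. fderiv f (p x) (s x)) has_derivative
     (\<lambda>w. \<Sum>b\<in>Basis. (s z \<bullet> b) *\<^sub>R fderiv2 f (p z) b (p' w) + (s' w \<bullet> b) *\<^sub>R fderiv f (p z) b)) (at z)"
    by (rule has_derivative_transform_within_open[OF _ U(1,2)]) (metis U(3) exp)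
  then show ?thesis
    by (simp add: exp2[of "s z"] exp[OF W(2), of "s' _"] sum.distrib)
qed

section \<open>Symmetry of second derivatives\<close>

lemma second_difference_mean_value:
  fixes f :: "'a::euclidean_space \<Rightarrow> real"
  assumes t: "0 < t" and f: "smooth_on W f"
    and W: "\<And>a b. 0 \<le> a \<Longrightarrow> a \<le> t \<Longrightarrow> 0 \<le> b \<Longrightarrow> b \<le> t \<Longrightarrow> z + a *\<^sub>R v + b *\<^sub>R w \<in> W"
  obtains a b where "0 < a" "a < t" "0 < b" "b < t"
    "f (z + t *\<^sub>R v + t *\<^sub>R w) - f (z + t *\<^sub>R v) - f (z + t *\<^sub>R w) + f z
      = t\<^sup>2 * fderiv2 f (z + a *\<^sub>R v + b *\<^sub>R w) v w"
proof -
  \<comment> \<open>The increment of \<open>\<phi>\<close> over \<open>[0, t]\<close> is the second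
    difference. The mean value theorem is applied to it in direction \<open>v\<close>, and then to
    the resulting directional derivative in direction \<open>w\<close>.\<close>
  define \<phi> where "\<phi> s = f (z + s *\<^sub>R v + t *\<^sub>R w) - f (z + s *\<^sub>R v)" for s
  have D: "((\<lambda>s. f (z + s *\<^sub>R v + r *\<^sub>R w)) has_real_derivative
      fderiv f (z + a *\<^sub>R v + r *\<^sub>R w) v) (at a)"
    if "0 \<le> a" "a \<le> t" "0 \<le> r" "r \<le> t" for a r
  proof -
    have d: "f differentiable at (z + a *\<^sub>R v + r *\<^sub>R w)"
      using smooth_on_differentiable[OF f W[OF that]] .
    have "((\<lambda>s. z + s *\<^sub>R v + r *\<^sub>R w) has_derivative (\<lambda>h. h *\<^sub>R v)) (at a)"
      by (auto intro!: derivative_eq_intros)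
    from has_derivative_compose[OF this has_fderiv[OF d]] show ?thesis
      by (simp add: has_field_derivative_def fderiv_linear[OF d] mult_commute_abs)
  qed
  have "\<exists>a. 0 < a \<and> a < t \<and> \<phi> t - \<phi> 0 = (t - 0) *
      (fderiv f (z + a *\<^sub>R v + t *\<^sub>R w) v - fderiv f (z + a *\<^sub>R v) v)"
    unfolding \<phi>_def
  proof (rule MVT2[OF t])
    fix x :: real assume x: "0 \<le> x" "x \<le> t"
    show "((\<lambda>s. f (z + s *\<^sub>R v + t *\<^sub>R w) - f (z + s *\<^sub>R v)) has_real_derivative
        fderiv f (z + x *\<^sub>R v + t *\<^sub>R w) v - fderiv f (z + x *\<^sub>R v) v) (at x)"
      using DERIV_diff[OF D[OF x, of t] D[OF x, of 0]] t by simp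
  qed
  then obtain a where a: "0 < a" "a < t" and \<phi>: "\<phi> t - \<phi> 0 = t *
      (fderiv f (z + a *\<^sub>R v + t *\<^sub>R w) v - fderiv f (z + a *\<^sub>R v) v)"
    by auto
  have "\<exists>b. 0 < b \<and> b < t \<and>
      fderiv f (z + a *\<^sub>R v + t *\<^sub>R w) v - fderiv f (z + a *\<^sub>R v + 0 *\<^sub>R w) v
      = (t - 0) * fderiv2 f (z + a *\<^sub>R v + b *\<^sub>R w) v w"
  proof (rule MVT2[OF t])
    fix x assume x: "0 \<le> x" "x \<le> t"
    have d: "(\<lambda>y. fderiv f y v) differentiable at (z + a *\<^sub>R v + x *\<^sub>R w)"
      using smooth_on_differentiable[OF smooth_on_fderiv[OF f] W] a x by simp
    have "((\<lambda>s. z + a *\<^sub>R v + s *\<^sub>R w) has_derivative (\<lambda>h. h *\<^sub>R w)) (at x)"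
      by (auto intro!: derivative_eq_intros)
    from has_derivative_compose[OF this has_fderiv[OF d]]
    show "((\<lambda>s. fderiv f (z + a *\<^sub>R v + s *\<^sub>R w) v) has_real_derivative
        fderiv2 f (z + a *\<^sub>R v + x *\<^sub>R w) v w) (at x)"
      by (simp add: has_field_derivative_def fderiv_linear[OF d] mult_commute_abs)
  qed
  then obtain b where "0 < b" "b < t"
      "fderiv f (z + a *\<^sub>R v + t *\<^sub>R w) v - fderiv f (z + a *\<^sub>R v) v
        = t * fderiv2 f (z + a *\<^sub>R v + b *\<^sub>R w) v w"
    by auto
  with a \<phi> show thesis
    by (intro that[of a b]) (auto simp: \<phi>_def power2_eq_square)
qed

text \<open>The second difference is symmetric in \<open>v\<close> and \<open>w\<close>. By the mean
  value theorem the two mixed derivatives therefore take equal values at two points arbitrarily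
  close to \<open>z\<close>, and continuity forces equality at \<open>z\<close>.\<close>

lemma fderiv2_commute_real:
  fixes f :: "'a::euclidean_space \<Rightarrow> real"
  assumes W: "open W" "z \<in> W" and f: "smooth_on W f"
  shows "fderiv2 f z v w = fderiv2 f z w v"
proof (rule ccontr)
  \<comment> \<open>Half the gap between the two mixed derivatives: no number is closer than this to
    both of them.\<close>
  define e where "e = \<bar>fderiv2 f z v w - fderiv2 f z w v\<bar> / 2"
  assume "fderiv2 f z v w \<noteq> fderiv2 f z w v"
  then have e: "e > 0"
    by (simp add: e_def)
  have near: "\<exists>d>0. \<forall>x. dist x z < d \<longrightarrow> dist (fderiv2 f x v w) (fderiv2 f z v w) < e" for v w
  proof -
    have "isCont (\<lambda>x. fderiv2 f x v w) z"
      using smooth_on_continuous[OF smooth_on_fderiv[OF smooth_on_fderiv[OF f]]] W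
      by (simp add: continuous_on_eq_continuous_at)
    then show ?thesis
      using e unfolding continuous_at_eps_delta by blast
  qed
  obtain d1 where d1: "d1 > 0" "\<And>x. dist x z < d1 \<Longrightarrow> dist (fderiv2 f x v w) (fderiv2 f z v w) < e"
    using near by blast
  obtain d2 where d2: "d2 > 0" "\<And>x. dist x z < d2 \<Longrightarrow> dist (fderiv2 f x w v) (fderiv2 f z w v) < e"
    using near by blast
  obtain d3 where d3: "d3 > 0" "ball z d3 \<subseteq> W"
    using W open_contains_ball by blast
  define d where "d = min d1 (min d2 d3)"
  \<comment> \<open>The parallelogram spanned by \<open>t *\<^sub>R v\<close> and
    \<open>t *\<^sub>R w\<close> stays within distance \<open>d\<close> of \<open>z\<close>; the
    summand 1 keeps the denominator positive when \<open>v\<close> and \<open>w\<close>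
    vanish.\<close>
  define t where "t = d / (norm v + norm w + 1)"
  have d: "d > 0"
    using d1 d2 d3 by (simp add: d_def)
  have t: "t > 0"
    unfolding t_def by (intro divide_pos_pos d) (smt (verit) norm_ge_zero)
  have close: "dist (z + a *\<^sub>R v + b *\<^sub>R w) z < d"
    if "0 \<le> a" "a \<le> t" "0 \<le> b" "b \<le> t" for a b
  proof -
    have "dist (z + a *\<^sub>R v + b *\<^sub>R w) z = norm (a *\<^sub>R v + b *\<^sub>R w)"
      by (simp add: dist_norm algebra_simps)
    also have "\<dots> \<le> t * norm v + t * norm w"
      by (rule norm_triangle_le) (use that in \<open>auto intro!: add_mono mult_right_mono\<close>)
    also have "\<dots> < t * (norm v + norm w + 1)"
      using t by (simp add: algebra_simps)
    also have "\<dots> = d"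
      unfolding t_def by (simp add: add_nonneg_pos less_imp_neq[symmetric])
    finally show ?thesis .
  qed
  have inW: "z + a *\<^sub>R v + b *\<^sub>R w \<in> W" if "0 \<le> a" "a \<le> t" "0 \<le> b" "b \<le> t" for a b
    using close[OF that] d3 by (auto simp: d_def dist_commute subset_iff)
  obtain a b where ab: "0 < a" "a < t" "0 < b" "b < t"
    and vw: "f (z + t *\<^sub>R v + t *\<^sub>R w) - f (z + t *\<^sub>R v) - f (z + t *\<^sub>R w) + f z
      = t\<^sup>2 * fderiv2 f (z + a *\<^sub>R v + b *\<^sub>R w) v w"
    using second_difference_mean_value[OF t f inW] by blast
  have inW': "z + b *\<^sub>R w + a *\<^sub>R v \<in> W" if "0 \<le> b" "b \<le> t" "0 \<le> a" "a \<le> t" for a b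
    using inW[OF that(3,4,1,2)] by (simp add: algebra_simps)
  obtain a' b' where ab': "0 < a'" "a' < t" "0 < b'" "b' < t"
    and wv: "f (z + t *\<^sub>R w + t *\<^sub>R v) - f (z + t *\<^sub>R w) - f (z + t *\<^sub>R v) + f z
      = t\<^sup>2 * fderiv2 f (z + a' *\<^sub>R w + b' *\<^sub>R v) w v"
    using second_difference_mean_value[OF t f inW'] by blast
  have "t\<^sup>2 * fderiv2 f (z + a *\<^sub>R v + b *\<^sub>R w) v w = t\<^sup>2 * fderiv2 f (z + b' *\<^sub>R v + a' *\<^sub>R w) w v"
    using vw wv by (simp add: algebra_simps)
  then have "fderiv2 f (z + a *\<^sub>R v + b *\<^sub>R w) v w = fderiv2 f (z + b' *\<^sub>R v + a' *\<^sub>R w) w v"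
    using t by simp
  moreover have "dist (fderiv2 f (z + a *\<^sub>R v + b *\<^sub>R w) v w) (fderiv2 f z v w) < e"
    using d1(2) close[of a b] ab by (simp add: d_def)
  moreover have "dist (fderiv2 f (z + b' *\<^sub>R v + a' *\<^sub>R w) w v) (fderiv2 f z w v) < e"
    using d2(2) close[of b' a'] ab' by (simp add: d_def)
  moreover have "\<bar>p - a\<bar> < \<bar>a - b\<bar> / 2 \<Longrightarrow> \<bar>p - b\<bar> < \<bar>a - b\<bar> / 2 \<Longrightarrow> False" for p a b :: real
    by (smt (verit) field_sum_of_halves)
  ultimately show False
    unfolding e_def dist_real_def by metis
qed

lemma k_times_differentiable_on_inner:
  fixes f :: "'a::euclidean_space \<Rightarrow> 'b::real_inner"
  assumes "open W" "k_times_differentiable_on k W f"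
  shows "k_times_differentiable_on k W (\<lambda>x. f x \<bullet> u)"
  using assms(2)
proof (induction k arbitrary: f)
  case 0
  then show ?case
    by (simp add: continuous_on_inner)
next
  case (Suc k)
  have D: "((\<lambda>x. f x \<bullet> u) has_derivative (\<lambda>v. fderiv f x v \<bullet> u)) (at x)" if "x \<in> W" for x
    by (intro has_derivative_inner_left has_fderiv) (use Suc.prems that in auto)
  have "k_times_differentiable_on k W (\<lambda>x. fderiv (\<lambda>x. f x \<bullet> u) x v)" for v
    by (rule k_times_differentiable_on_cong[OF assms(1) _ Suc.IH[of "\<lambda>x. fderiv f x v"]])
      (use Suc.prems fderiv_eq[OF D] in auto)
  then show ?case
    using D by (auto simp: differentiable_def)
qed

text \<open>Pairing with a fixed vector reduces the claim to the real case. Taking for this vector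
  the difference \<open>u\<close> of the two sides gives \<open>u \<bullet> u = 0\<close>.\<close>

lemma fderiv2_commute:
  fixes f :: "'a::euclidean_space \<Rightarrow> 'b::real_inner"
  assumes W: "open W" "z \<in> W" and f: "smooth_on W f"
  shows "fderiv2 f z v w = fderiv2 f z w v"
proof -
  define u where "u = fderiv2 f z v w - fderiv2 f z w v"
  have sm: "smooth_on W (\<lambda>x. f x \<bullet> u)"
    using f k_times_differentiable_on_inner[OF W(1)] by (auto simp: smooth_on_def)
  have D: "((\<lambda>x. f x \<bullet> u) has_derivative (\<lambda>v. fderiv f x v \<bullet> u)) (at x)" if "x \<in> W" for x
    by (intro has_derivative_inner_left has_fderiv smooth_on_differentiable[OF f that])
  have "fderiv2 (\<lambda>x. f x \<bullet> u) z v w = fderiv2 f z v w \<bullet> u" for v w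
  proof -
    have "fderiv2 (\<lambda>x. f x \<bullet> u) z v = fderiv (\<lambda>x. fderiv f x v \<bullet> u) z"
      by (rule fderiv_cong_open[OF W]) (simp add: fderiv_eq[OF D])
    also have "\<dots> = (\<lambda>w. fderiv2 f z v w \<bullet> u)"
      by (intro fderiv_eq has_derivative_inner_left has_fderiv
          smooth_on_differentiable[OF smooth_on_fderiv[OF f] W(2)])
    finally show ?thesis
      by simp
  qed
  then have "u \<bullet> u = 0"
    using fderiv2_commute_real[OF W sm, of v w] by (simp add: u_def inner_diff_left)
  then show ?thesis
    by (simp add: u_def)
qed

section \<open>Finsler metrizable sprays in one chart\<close>

lemma has_derivative_fst_at: "(fst has_derivative fst) (at z)"
  by (rule bounded_linear_imp_has_derivative[OF bounded_linear_fst])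

lemma has_derivative_snd_at: "(snd has_derivative snd) (at z)"
  by (rule bounded_linear_imp_has_derivative[OF bounded_linear_snd])

lemma has_derivative_fderiv_at:
  fixes f :: "'a::euclidean_space \<Rightarrow> 'b::real_normed_vector"
  assumes W: "open W" "z \<in> W" and f: "smooth_on W f" and s: "(s has_derivative s') (at z)"
  shows "((\<lambda>x. fderiv f x (s x)) has_derivative
           (\<lambda>w. fderiv2 f z (s z) w + fderiv f z (s' w))) (at z)"
  using has_derivative_fderiv_apply[where p = "\<lambda>x. x" and W = W, OF W(1) _ f _ s] W(2) by simp

text \<open>Uniqueness of derivatives allows an identity on an open set to be differentiated.
  Euler's relation, the semispray condition and the conservation of energy are all differentiated in
  this way.\<close>

lemma has_derivative_eq_open:
  assumes "open W" "z \<in> W" "\<And>x. x \<in> W \<Longrightarrow> f x = g x"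
    and "(f has_derivative f') (at z)" "(g has_derivative g') (at z)"
  shows "f' w = g' w"
  using has_derivative_transform_within_open[OF assms(4,1,2,3)] assms(5)
  by (metis has_derivative_unique)

text \<open>
  For \<open>\<omega> = ddJ E\<close> and a semispray \<open>s\<close> of a 2-homogeneous \<open>E\<close>, the assumption
  \<open>geodesic\<close> reads \<open>\<omega>(s, w) = - dE(w)\<close>.
\<close>
lemma euler_lagrange_at_point:
  fixes E :: "'a::euclidean_space \<times> 'a \<Rightarrow> real"
  assumes W: "open W" "z \<in> W" and E: "smooth_on W E"
    and euler: "\<And>x. x \<in> W \<Longrightarrow> fderiv E x (0, snd x) = 2 * E x"
    and s: "fst s = snd z"
    and geodesic: "\<And>w. fderiv2 E z (0, fst w) s - fderiv2 E z (0, fst s) w = - fderiv E z w"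
  shows "fderiv E z s = 0" and "fderiv2 E z (0, e) s = fderiv E z (e, 0)"
proof -
  show "fderiv E z s = 0"
    \<comment> \<open>For \<open>w = s\<close> the two terms on the left of the geodesic equation
      cancel.\<close>
    using geodesic[of s] by simp
  have sd: "((\<lambda>x. (0, snd x)) has_derivative (\<lambda>w. (0, snd w))) (at z)"
    by (intro has_derivative_Pair has_derivative_snd_at) simp
  have E': "((\<lambda>x. 2 * E x) has_derivative (\<lambda>w. 2 * fderiv E z w)) (at z)"
    by (intro has_derivative_mult_right has_fderiv smooth_on_differentiable[OF E W(2)])
  have "fderiv2 E z (0, snd z) w + fderiv E z (0, snd w) = 2 * fderiv E z w" for w
    using has_derivative_eq_open[OF W euler has_derivative_fderiv_at[OF W E sd] E'] by simp
  \<comment> \<open>On \<open>(e, 0)\<close> the differentiated Euler relation turns the second term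
    of the geodesic equation into \<open>2 * fderiv E z (e, 0)\<close>, one copy of which cancels
    against the right side.\<close>
  from this[of "(e, 0)"] geodesic[of "(e, 0)"] s
  show "fderiv2 E z (0, e) s = fderiv E z (e, 0)"
    using fderiv_linear(5)[OF smooth_on_differentiable[OF E W(2)]] by (simp flip: zero_prod_def)
qed

text \<open>
  With \<open>\<tau>\<^sub>0\<close> a change of coordinates of \<open>M\<close>, the map below is the induced change of coordinates
  of the tangent bundle.
\<close>
definition tangent_map :: "('a::euclidean_space \<Rightarrow> 'a) \<Rightarrow> 'a \<times> 'a \<Rightarrow> 'a \<times> 'a" where
  "tangent_map \<tau>\<^sub>0 z = (\<tau>\<^sub>0 (fst z), fderiv \<tau>\<^sub>0 (fst z) (snd z))"

lemma has_derivative_tangent_map: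
  assumes "open U" "fst z \<in> U" "smooth_on U \<tau>\<^sub>0"
  shows "(tangent_map \<tau>\<^sub>0 has_derivative
      (\<lambda>w. (fderiv \<tau>\<^sub>0 (fst z) (fst w),
            fderiv2 \<tau>\<^sub>0 (fst z) (snd z) (fst w) + fderiv \<tau>\<^sub>0 (fst z) (snd w)))) (at z)"
  unfolding tangent_map_def
  by (intro has_derivative_Pair has_derivative_fderiv_apply[where W = U] assms
      has_derivative_fst_at has_derivative_snd_at has_derivative_compose[OF has_derivative_fst_at]
      has_fderiv smooth_on_differentiable[OF assms(3)])

text \<open>By the chain rule, second derivatives of \<open>\<tau>\<^sub>0\<close> enter on the left
  through the moving vertical vector \<open>(0, ?T x e)\<close> and on the right through the
  vertical part of the image of \<open>(e, 0)\<close>. The two contributions agree because second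
  derivatives commute.\<close>

lemma euler_lagrange_change_chart:
  fixes E\<^sub>1 E\<^sub>2 :: "'a::euclidean_space \<times> 'a \<Rightarrow> real"
  assumes U: "open U" "smooth_on U \<tau>\<^sub>0"
    and W\<^sub>1: "open W\<^sub>1" "z \<in> W\<^sub>1" "fst ` W\<^sub>1 \<subseteq> U" and W\<^sub>2: "open W\<^sub>2" "tangent_map \<tau>\<^sub>0 ` W\<^sub>1 \<subseteq> W\<^sub>2"
    and E: "smooth_on W\<^sub>1 E\<^sub>1" "smooth_on W\<^sub>2 E\<^sub>2"
    and E\<^sub>1: "\<And>x. x \<in> W\<^sub>1 \<Longrightarrow> E\<^sub>1 x = E\<^sub>2 (tangent_map \<tau>\<^sub>0 x)"
    and s: "fst s\<^sub>1 = snd z" "s\<^sub>2 = fderiv (tangent_map \<tau>\<^sub>0) z s\<^sub>1"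
    and EL: "\<And>e. fderiv2 E\<^sub>2 (tangent_map \<tau>\<^sub>0 z) (0, e) s\<^sub>2 = fderiv E\<^sub>2 (tangent_map \<tau>\<^sub>0 z) (e, 0)"
  shows "fderiv2 E\<^sub>1 z (0, e) s\<^sub>1 = fderiv E\<^sub>1 z (e, 0)"
proof -
  let ?\<tau> = "tangent_map \<tau>\<^sub>0" and ?T = "\<lambda>x. fderiv \<tau>\<^sub>0 (fst x)"
  have inU: "fst x \<in> U" if "x \<in> W\<^sub>1" for x
    using W\<^sub>1(3) that by auto
  have inW\<^sub>2: "?\<tau> x \<in> W\<^sub>2" if "x \<in> W\<^sub>1" for x
    using W\<^sub>2(2) that by auto
  note \<tau>' = has_derivative_tangent_map[OF U(1) inU U(2)]
  have T0: "?T x 0 = 0" if "x \<in> W\<^sub>1" for x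
    using fderiv_linear(5)[OF smooth_on_differentiable[OF U(2) inU[OF that]]] .
  have T2: "fderiv2 \<tau>\<^sub>0 (fst z) 0 w = 0" for w
  proof -
    have "fderiv (\<lambda>x. fderiv \<tau>\<^sub>0 x 0) (fst z) = fderiv (\<lambda>x. 0) (fst z)"
      by (rule fderiv_cong_open[OF U(1) inU[OF W\<^sub>1(2)]])
        (rule fderiv_linear(5)[OF smooth_on_differentiable[OF U(2)]])
    then show ?thesis
      by simp
  qed
  have D1: "fderiv E\<^sub>1 x w = fderiv E\<^sub>2 (?\<tau> x) (fderiv ?\<tau> x w)" if x: "x \<in> W\<^sub>1" for x w
  proof -
    have "((\<lambda>y. E\<^sub>2 (?\<tau> y)) has_derivative (\<lambda>w. fderiv E\<^sub>2 (?\<tau> x) (fderiv ?\<tau> x w))) (at x)"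
      using has_derivative_compose[OF \<tau>'[OF x]
          has_fderiv[OF smooth_on_differentiable[OF E(2) inW\<^sub>2[OF x]]]]
      by (simp add: fderiv_eq[OF \<tau>'[OF x]])
    then have "(E\<^sub>1 has_derivative (\<lambda>w. fderiv E\<^sub>2 (?\<tau> x) (fderiv ?\<tau> x w))) (at x)"
      by (rule has_derivative_transform_within_open[OF _ W\<^sub>1(1) x]) (simp add: E\<^sub>1)
    then show ?thesis
      by (simp add: fderiv_eq)
  qed
  \<comment> \<open>The tangent map is linear on fibres, so vertical vectors stay vertical and no
    second derivative of \<open>\<tau>\<^sub>0\<close> survives here.\<close>
  have vert: "fderiv E\<^sub>1 x (0, e) = fderiv E\<^sub>2 (?\<tau> x) (0, ?T x e)" if x: "x \<in> W\<^sub>1" for x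
  proof -
    have "fderiv2 \<tau>\<^sub>0 (fst x) (snd x) 0 = 0"
      by (rule fderiv_linear(5)[OF smooth_on_differentiable[OF smooth_on_fderiv[OF U(2)] inU[OF x]]])
    then show ?thesis
      by (simp add: D1[OF x] fderiv_eq[OF \<tau>'[OF x]] T0[OF x])
  qed
  have T': "((\<lambda>x. (0, ?T x e)) has_derivative (\<lambda>w. (0, fderiv2 \<tau>\<^sub>0 (fst z) e (fst w)))) (at z)"
    by (intro has_derivative_Pair has_derivative_const
        has_derivative_compose[OF has_derivative_fst_at] has_fderiv
        smooth_on_differentiable[OF smooth_on_fderiv[OF U(2)] inU[OF W\<^sub>1(2)]])
  have "fderiv2 E\<^sub>1 z (0, e) w =
      fderiv2 E\<^sub>2 (?\<tau> z) (0, ?T z e) (fderiv ?\<tau> z w)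
      + fderiv E\<^sub>2 (?\<tau> z) (0, fderiv2 \<tau>\<^sub>0 (fst z) e (fst w))" for w
    using has_derivative_eq_open[OF W\<^sub>1(1,2) vert
        has_fderiv[OF smooth_on_differentiable[OF smooth_on_fderiv[OF E(1)] W\<^sub>1(2)]]
        has_derivative_fderiv_apply[OF W\<^sub>2(1) inW\<^sub>2[OF W\<^sub>1(2)] E(2) \<tau>'[OF W\<^sub>1(2)] T']]
    by (simp add: fderiv_eq[OF \<tau>'[OF W\<^sub>1(2)]])
  then have "fderiv2 E\<^sub>1 z (0, e) s\<^sub>1 = fderiv E\<^sub>2 (?\<tau> z) (?T z e, 0)
      + fderiv E\<^sub>2 (?\<tau> z) (0, fderiv2 \<tau>\<^sub>0 (fst z) e (snd z))"
    using EL s by simp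
  also have "\<dots> = fderiv E\<^sub>2 (?\<tau> z) ((?T z e, 0) + (0, fderiv2 \<tau>\<^sub>0 (fst z) e (snd z)))"
    by (rule fderiv_linear(1)[OF smooth_on_differentiable[OF E(2) inW\<^sub>2[OF W\<^sub>1(2)]], symmetric])
  also have "\<dots> = fderiv E\<^sub>1 z (e, 0)"
    using fderiv2_commute[OF U(1) inU[OF W\<^sub>1(2)] U(2), of e "snd z"]
    by (simp add: D1[OF W\<^sub>1(2)] fderiv_eq[OF \<tau>'[OF W\<^sub>1(2)]] T0[OF W\<^sub>1(2)])
  finally show ?thesis .
qed

text \<open>For \<open>s = (y, - 2 G)\<close> the second component is minus \<partial>G/\<partial>y
  applied to \<open>a\<close>. So this is the horizontal lift of \<open>a\<close> for the nonlinear
  connection of the spray.\<close>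

definition hlift :: "('a::real_normed_vector \<times> 'a \<Rightarrow> 'a \<times> 'a) \<Rightarrow> 'a \<times> 'a \<Rightarrow> 'a \<Rightarrow> 'a \<times> 'a" where
  "hlift s z a = (a, (1/2) *\<^sub>R snd (fderiv s z (0, a)))"

section \<open>Energy and curvature of a spray in one chart\<close>

locale semispray_chart =
  fixes W :: "('a::euclidean_space \<times> 'a) set" and s :: "'a \<times> 'a \<Rightarrow> 'a \<times> 'a"
  assumes open_W: "open W" and smooth_s: "smooth_on W s"
    and semispray: "z \<in> W \<Longrightarrow> fst (s z) = snd z"
begin

lemma differentiable_s: "z \<in> W \<Longrightarrow> s differentiable at z"
  using smooth_s by (rule smooth_on_differentiable)

lemma fst_fderiv_semispray:
  assumes z: "z \<in> W"
  shows "fst (fderiv s z w) = snd w"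
  using has_derivative_eq_open[OF open_W z semispray
      has_derivative_fst[OF has_fderiv[OF differentiable_s[OF z]]] has_derivative_snd_at] .

lemma hlift_minus:
  assumes z: "z \<in> W"
  shows "hlift s z (- a) = - hlift s z a"
  using fderiv_linear(4)[OF differentiable_s[OF z], of "(0, a)"] by (simp add: hlift_def)

lemma differentiable_hlift:
  assumes z: "z \<in> W"
  shows "(\<lambda>x. hlift s x a) differentiable at z"
proof -
  have "((\<lambda>x. hlift s x a) has_derivative (\<lambda>w. (0, (1/2) *\<^sub>R snd (fderiv2 s z (0, a) w)))) (at z)"
    unfolding hlift_def
    by (intro has_derivative_Pair has_derivative_const has_derivative_scaleR_right
        has_derivative_snd has_fderiv smooth_on_differentiable[OF smooth_on_fderiv[OF smooth_s] z])
  then show ?thesis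
    by (auto simp: differentiable_def)
qed

end

text \<open>The assumption \<open>euler_lagrange\<close> says that the derivative of
  \<partial>E/\<partial>y along \<open>s\<close> is \<partial>E/\<partial>x, and
  \<open>energy\<close> that \<open>E\<close> is conserved along \<open>s\<close>. Together they
  represent the geodesic equation in the curvature computation.\<close>

locale finsler_chart = semispray_chart W s
  for W :: "('a::euclidean_space \<times> 'a) set" and s :: "'a \<times> 'a \<Rightarrow> 'a \<times> 'a" +
  fixes E :: "'a \<times> 'a \<Rightarrow> real"
  assumes smooth_E: "smooth_on W E"
    and euler_lagrange: "z \<in> W \<Longrightarrow> fderiv2 E z (0, e) (s z) = fderiv E z (e, 0)"
    and energy: "z \<in> W \<Longrightarrow> fderiv E z (s z) = 0"
begin

lemma differentiable_E: "z \<in> W \<Longrightarrow> E differentiable at z"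
  using smooth_E by (rule smooth_on_differentiable)

lemma fderiv_energy:
  assumes z: "z \<in> W"
  shows "fderiv2 E z (s z) w + fderiv E z (fderiv s z w) = 0"
  using has_derivative_eq_open[OF open_W z energy has_derivative_fderiv_at
      [OF open_W z smooth_E has_fderiv[OF differentiable_s[OF z]]] has_derivative_const[of 0]] .

text \<open>Differentiating \<open>energy\<close> in the vertical direction \<open>(0, a)\<close>
  and rewriting the second derivative by \<open>euler_lagrange\<close> shows that
  \<open>(a, 0) + fderiv s z (0, a)\<close> annihilates \<open>E\<close>. This vector is twice the
  lift of \<open>a\<close>.\<close>

lemma fderiv_hlift:
  assumes z: "z \<in> W"
  shows "fderiv E z (hlift s z a) = 0"
proof -
  have "fderiv E z (2 *\<^sub>R hlift s z a) = fderiv E z ((a, 0) + fderiv s z (0, a))"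
    using fst_fderiv_semispray[OF z, of "(0, a)"]
    by (intro arg_cong[where f = "fderiv E z"]) (simp add: hlift_def prod_eq_iff scaleR_2)
  also have "\<dots> = fderiv E z (a, 0) + fderiv E z (fderiv s z (0, a))"
    by (rule fderiv_linear(1)[OF differentiable_E[OF z]])
  also have "\<dots> = 0"
    using fderiv_energy[OF z, of "(0, a)"] euler_lagrange[OF z, of a]
      fderiv2_commute[OF open_W z smooth_E, of "s z" "(0, a)"] by simp
  finally show ?thesis
    by (simp add: fderiv_linear(3)[OF differentiable_E[OF z]])
qed

text \<open>Both \<open>s\<close> and \<open>hlift s _ a\<close> annihilate \<open>E\<close>, hence so does their commutator.\<close>
lemma fderiv_bracket_hlift:
  assumes z: "z \<in> W"
  shows "fderiv E z (fderiv (\<lambda>x. hlift s x a) z (s z) - fderiv s z (hlift s z a)) = 0"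
proof -
  have "fderiv2 E z (hlift s z a) w + fderiv E z (fderiv (\<lambda>x. hlift s x a) z w) = 0" for w
    using has_derivative_eq_open[OF open_W z fderiv_hlift has_derivative_fderiv_at
      [OF open_W z smooth_E has_fderiv[OF differentiable_hlift[OF z]]] has_derivative_const[of 0]] .
  from this[of "s z"] fderiv_energy[OF z, of "hlift s z a"]
    fderiv2_commute[OF open_W z smooth_E, of "s z" "hlift s z a"]
  show ?thesis
    unfolding fderiv_linear(2)[OF differentiable_E[OF z]] by linarith
qed

text \<open>The vector \<open>w\<close> is \<open>[S, h]\<close> applied to \<open>(a, b)\<close> in
  the chart, and subtracting its horizontal part gives the value of the Jacobi endomorphism. It
  annihilates \<open>E\<close> because the commutator and all horizontal lifts do.\<close>

lemma fderiv_jacobi: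
  fixes a b
  assumes z: "z \<in> W"
  defines "w \<equiv> fderiv (\<lambda>x. hlift s x a) z (s z) - fderiv s z (hlift s z a) + hlift s z b"
  shows "fderiv E z (w - hlift s z (fst w)) = 0"
  unfolding w_def
  by (subst fderiv_linear(2)[OF differentiable_E[OF z]], subst fderiv_linear(1)[OF differentiable_E[OF z]])
    (simp add: fderiv_bracket_hlift[OF z] fderiv_hlift[OF z])

end

section \<open>Vanishing of the projective factor\<close>

lemma fibrewise_constant:
  fixes f :: "'a::euclidean_space \<times> 'a \<Rightarrow> real"
  assumes dim: "DIM('a) \<ge> 2" and f: "\<And>y. y \<noteq> 0 \<Longrightarrow> f differentiable at (x, y)"
    and D: "\<And>y e. y \<noteq> 0 \<Longrightarrow> fderiv f (x, y) (0, e) = 0"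
    and y: "y \<noteq> 0" "y' \<noteq> 0"
  shows "f (x, y) = f (x, y')"
proof (rule has_derivative_zero_unique_connected[where s = "- {0}" and f = "\<lambda>y. f (x, y)"])
  fix y :: 'a assume "y \<in> - {0}"
  then have y: "y \<noteq> 0"
    by simp
  have "((\<lambda>y. (x, y)) has_derivative (\<lambda>e. (0, e))) (at y)"
    by (intro has_derivative_Pair) auto
  from has_derivative_compose[OF this has_fderiv[OF f[OF y]]]
  show "((\<lambda>y. f (x, y)) has_derivative (\<lambda>e. 0)) (at y)"
    by (simp add: D[OF y])
\<comment> \<open>Dimension at least two makes the punctured fibre connected; a punctured line would
  allow two independent constants.\<close>
qed (use y dim connected_punctured_universe in auto)

lemma exists_kernel_vector:
  fixes l :: "'a::euclidean_space \<Rightarrow> real"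
  assumes "DIM('a) \<ge> 2" "linear l"
  obtains v where "v \<noteq> 0" "l v = 0"
proof -
  \<comment> \<open>The basis sum represents \<open>l\<close> as an inner product, so vectors
    orthogonal to it lie in the kernel.\<close>
  obtain v where v: "v \<noteq> 0" "orthogonal (\<Sum>b\<in>Basis. l b *\<^sub>R b) v"
    using orthogonal_to_vector_exists[OF assms(1)] .
  have "l v = l (\<Sum>b\<in>Basis. (v \<bullet> b) *\<^sub>R b)"
    by (simp add: euclidean_representation)
  also have "\<dots> = (\<Sum>b\<in>Basis. l b *\<^sub>R b) \<bullet> v"
    by (simp add: linear_sum[OF assms(2)] linear_cmul[OF assms(2)] inner_sum_left inner_commute[of v])
      (simp add: mult.commute)
  also have "\<dots> = 0"
    using v by (simp add: orthogonal_def)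
  finally show ?thesis
    using that v by blast
qed

text \<open>By \<open>dJ\<close>, the vertical differentials of ln \<open>E\<^sub>1\<close> and ln
  \<open>E\<^sub>2\<close> agree, so the quotient of the energies depends on the base point only.
  Comparing \<open>h\<^sub>1\<close> with \<open>h\<^sub>2\<close> then expresses \<open>P\<close>
  through its differential. \<open>W\<close> consists of whole punctured fibres because constancy is
  needed along all of a fibre.\<close>

lemma projective_factor_zero:
  fixes E\<^sub>1 E\<^sub>2 P :: "'a::euclidean_space \<times> 'a \<Rightarrow> real" and s\<^sub>1 s\<^sub>2 :: "'a \<times> 'a \<Rightarrow> 'a \<times> 'a"
  assumes dim: "DIM('a) \<ge> 2" and U: "open U" and W: "W = U \<times> (- {0})"
    and E\<^sub>1: "\<And>z. z \<in> W \<Longrightarrow> E\<^sub>1 differentiable at z" "\<And>z. z \<in> W \<Longrightarrow> E\<^sub>1 z > 0"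
    and E\<^sub>2: "\<And>z. z \<in> W \<Longrightarrow> E\<^sub>2 differentiable at z" "\<And>z. z \<in> W \<Longrightarrow> E\<^sub>2 z > 0"
    and euler: "\<And>z. z \<in> W \<Longrightarrow> fderiv E\<^sub>1 z (0, snd z) = 2 * E\<^sub>1 z"
    and P: "\<And>z. z \<in> W \<Longrightarrow> P differentiable at z" "\<And>z. z \<in> W \<Longrightarrow> fderiv P z (0, snd z) = P z"
    and s\<^sub>1: "\<And>z. z \<in> W \<Longrightarrow> s\<^sub>1 differentiable at z"
    and s\<^sub>2: "\<And>z. z \<in> W \<Longrightarrow> s\<^sub>2 z = s\<^sub>1 z - (2 * P z) *\<^sub>R (0, snd z)"
    and dJ: "\<And>z e. z \<in> W \<Longrightarrow> fderiv E\<^sub>1 z (0, e) * E\<^sub>2 z = fderiv E\<^sub>2 z (0, e) * E\<^sub>1 z"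
    and h\<^sub>1: "\<And>z e. z \<in> W \<Longrightarrow> fderiv E\<^sub>1 z (hlift s\<^sub>1 z e) = 0"
    and h\<^sub>2: "\<And>z e. z \<in> W \<Longrightarrow> fderiv E\<^sub>2 z (hlift s\<^sub>2 z e) = 0"
    and z: "z \<in> W"
  shows "P z = 0"
proof -
  have oW: "open W"
    unfolding W by (intro open_Times U open_Compl closed_singleton)
  define q where "q z = E\<^sub>2 z / E\<^sub>1 z" for z
  have E\<^sub>1_nz: "E\<^sub>1 z \<noteq> 0" if "z \<in> W" for z
    using E\<^sub>1(2)[OF that] by simp
  have q_pos: "q z > 0" if "z \<in> W" for z
    using E\<^sub>1(2)[OF that] E\<^sub>2(2)[OF that] by (simp add: q_def)
  have q': "(q has_derivative (\<lambda>w. (fderiv E\<^sub>2 z w * E\<^sub>1 z - E\<^sub>2 z * fderiv E\<^sub>1 z w) / (E\<^sub>1 z * E\<^sub>1 z))) (at z)"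
    if "z \<in> W" for z
    unfolding q_def
    by (rule has_derivative_divide'[OF has_fderiv[OF E\<^sub>2(1)] has_fderiv[OF E\<^sub>1(1)]])
      (use that E\<^sub>1_nz in auto)
  have dq: "q differentiable at z" if "z \<in> W" for z
    using q'[OF that] by (auto simp: differentiable_def)
  have Dq: "fderiv E\<^sub>2 z w = fderiv q z w * E\<^sub>1 z + q z * fderiv E\<^sub>1 z w" if "z \<in> W" for z w
    using E\<^sub>1_nz[OF that] by (simp add: fderiv_eq[OF q'[OF that]] q_def field_simps)
  have Dq_vert: "fderiv q z (0, e) = 0" if "z \<in> W" for z e
    using dJ[OF that, of e] by (simp add: fderiv_eq[OF q'[OF that]] mult.commute)
  have star: "fderiv q z (e, 0) * E\<^sub>1 z = q z * (2 * E\<^sub>1 z * fderiv P z (0, e) + P z * fderiv E\<^sub>1 z (0, e))"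
    if zW: "z \<in> W" for z e
  proof -
    \<comment> \<open>Half the derivative of \<open>2 P y\<close> in the fibre direction
      \<open>e\<close>: the amount by which the horizontal lifts of the two sprays differ.\<close>
    let ?v = "(0, fderiv P z (0, e) *\<^sub>R snd z + P z *\<^sub>R e)"
    have "((\<lambda>x. s\<^sub>1 x - (2 * P x) *\<^sub>R (0, snd x)) has_derivative
        (\<lambda>w. fderiv s\<^sub>1 z w - ((2 * P z) *\<^sub>R (0, snd w) + (2 * fderiv P z w) *\<^sub>R (0, snd z)))) (at z)"
      by (intro has_derivative_diff has_derivative_scaleR has_derivative_mult_right has_derivative_Pair
          has_derivative_const has_derivative_snd_at has_fderiv s\<^sub>1[OF zW] P(1)[OF zW])
    then have "(s\<^sub>2 has_derivative
        (\<lambda>w. fderiv s\<^sub>1 z w - ((2 * P z) *\<^sub>R (0, snd w) + (2 * fderiv P z w) *\<^sub>R (0, snd z)))) (at z)"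
      by (rule has_derivative_transform_within_open[OF _ oW zW]) (simp add: s\<^sub>2)
    from fderiv_eq[OF this] have "hlift s\<^sub>2 z e = hlift s\<^sub>1 z e - ?v"
      by (simp add: hlift_def algebra_simps)
    then have 1: "0 = fderiv E\<^sub>2 z (hlift s\<^sub>1 z e) - fderiv E\<^sub>2 z ?v"
      using h\<^sub>2[OF zW, of e] by (simp add: fderiv_linear(2)[OF E\<^sub>2(1)[OF zW]])
    have "hlift s\<^sub>1 z e = (e, 0) + (0, snd (hlift s\<^sub>1 z e))"
      by (simp add: hlift_def)
    \<comment> \<open>As \<open>q\<close> has no vertical derivative, only the base component of the
      lift matters.\<close>
    then have "fderiv q z (hlift s\<^sub>1 z e) = fderiv q z (e, 0)"
      using fderiv_linear(1)[OF dq[OF zW], of "(e, 0)"] Dq_vert[OF zW] by (metis add.right_neutral)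
    then have 2: "fderiv E\<^sub>2 z (hlift s\<^sub>1 z e) = fderiv q z (e, 0) * E\<^sub>1 z"
      by (simp add: Dq[OF zW] h\<^sub>1[OF zW])
    have "fderiv E\<^sub>1 z ?v = fderiv E\<^sub>1 z (fderiv P z (0, e) *\<^sub>R (0, snd z) + P z *\<^sub>R (0, e))"
      by simp
    also have "\<dots> = fderiv P z (0, e) * (2 * E\<^sub>1 z) + P z * fderiv E\<^sub>1 z (0, e)"
      by (simp only: fderiv_linear[OF E\<^sub>1(1)[OF zW]] euler[OF zW] real_scaleR_def)
    finally show ?thesis
      using 1 2 by (simp add: Dq[OF zW] Dq_vert[OF zW] mult_ac)
  qed
  \<comment> \<open>Contraction of \<open>star\<close> with the fibre coordinate: by Euler's
    relations for \<open>P\<close> and \<open>E\<^sub>1\<close>, both terms in the bracket become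
    \<open>2 * E\<^sub>1 z * P z\<close>.\<close>
  have P_eq: "fderiv q z (snd z, 0) = 4 * q z * P z" if "z \<in> W" for z
    using star[OF that, of "snd z"] E\<^sub>1_nz[OF that] by (simp add: euler[OF that] P(2)[OF that])
  obtain x y where xy: "z = (x, y)" "x \<in> U" "y \<noteq> 0"
    using z W by auto
  have inW: "(x', v) \<in> W" if "x' \<in> U" "v \<noteq> 0" for x' v
    using that W by simp
  have q_const: "q (x', v) = q (x', y)" if "x' \<in> U" "v \<noteq> 0" for x' v
    using fibrewise_constant[OF dim, of q x' v y] dq Dq_vert inW that xy(3) by blast
  \<comment> \<open>Read off from \<open>P_eq\<close>, but with \<open>q\<close> and its derivative
    frozen at the reference point \<open>y\<close> of the fibre, which makes it linear in
    \<open>e\<close>.\<close>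
  define l where "l e = fderiv q (x, y) (e, 0) / (4 * q (x, y))" for e
  have l: "linear l"
  proof (rule linearI)
    fix a b and r :: real
    show "l (a + b) = l a + l b"
      using fderiv_linear(1)[OF dq[OF inW[OF xy(2,3)]], of "(a, 0)" "(b, 0)"]
      by (simp add: l_def add_divide_distrib)
    show "l (r *\<^sub>R a) = r *\<^sub>R l a"
      using fderiv_linear(3)[OF dq[OF inW[OF xy(2,3)]], of r "(a, 0)"] by (simp add: l_def)
  qed
  \<comment> \<open>Fibrewise constancy of \<open>q\<close> holds over every base point of
    \<open>U\<close>, so it can be differentiated in the base directions.\<close>
  have Dq_const: "fderiv q (x, v) (e, 0) = fderiv q (x, y) (e, 0)" if v: "v \<noteq> 0" for v e
  proof -
    have D: "((\<lambda>x. q (x, v)) has_derivative (\<lambda>e. fderiv q (x, v) (e, 0))) (at x)" if v: "v \<noteq> 0" for v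
    proof -
      have "((\<lambda>x. (x, v)) has_derivative (\<lambda>e. (e, 0))) (at x)"
        by (intro has_derivative_Pair) auto
      from has_derivative_compose[OF this has_fderiv[OF dq[OF inW[OF xy(2) v]]]] show ?thesis .
    qed
    show ?thesis
      by (rule has_derivative_eq_open[OF U xy(2) _ D[OF v] D[OF xy(3)]]) (use q_const v in auto)
  qed
  have P_l: "P (x, v) = l v" if v: "v \<noteq> 0" for v
    using P_eq[OF inW[OF xy(2) v]] Dq_const[OF v] q_const[OF xy(2) v] q_pos[OF inW[OF xy(2,3)]]
    by (simp add: l_def)
  have DP: "fderiv P (x, v) (0, e) = l e" if v: "v \<noteq> 0" for v e
  proof -
    have "((\<lambda>y. (x, y)) has_derivative (\<lambda>e. (0, e))) (at v)"
      by (intro has_derivative_Pair) auto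
    from has_derivative_compose[OF this has_fderiv[OF P(1)[OF inW[OF xy(2) v]]]]
    have 1: "((\<lambda>y. P (x, y)) has_derivative (\<lambda>e. fderiv P (x, v) (0, e))) (at v)" .
    have 2: "(l has_derivative l) (at v)"
      using l linear_conv_bounded_linear bounded_linear_imp_has_derivative by blast
    show ?thesis
      by (rule has_derivative_eq_open[where W = "- {0}", OF _ _ _ 1 2]) (use v P_l in auto)
  qed
  \<comment> \<open>This is \<open>star\<close> with \<open>P\<close> and its vertical derivative
    replaced by \<open>l\<close>; the derivative of \<open>q\<close> contributes
    \<open>4 * l e\<close>. Up to the factor \<open>l v\<close> it is the vanishing of the vertical
    derivative of \<open>P\<^sup>2 / E\<^sub>1\<close>, cleared of denominators.\<close>
  have key: "2 * l e * E\<^sub>1 (x, v) = l v * fderiv E\<^sub>1 (x, v) (0, e)" if v: "v \<noteq> 0" for v e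
  proof -
    have "q (x, y) * (4 * l e * E\<^sub>1 (x, v)) =
        q (x, y) * (2 * E\<^sub>1 (x, v) * l e + l v * fderiv E\<^sub>1 (x, v) (0, e))"
      using star[OF inW[OF xy(2) v], of e] q_pos[OF inW[OF xy(2,3)]]
      by (simp add: Dq_const[OF v] q_const[OF xy(2) v] P_l[OF v] DP[OF v] l_def)
    then have "4 * l e * E\<^sub>1 (x, v) = 2 * E\<^sub>1 (x, v) * l e + l v * fderiv E\<^sub>1 (x, v) (0, e)"
      using q_pos[OF inW[OF xy(2,3)]] by (metis less_irrefl mult_left_cancel)
    then show ?thesis
      by simp
  qed
  define f where "f z = P z * P z / E\<^sub>1 z" for z
  have f': "(f has_derivative (\<lambda>w. ((P (x, v) * fderiv P (x, v) w + fderiv P (x, v) w * P (x, v)) * E\<^sub>1 (x, v)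
      - P (x, v) * P (x, v) * fderiv E\<^sub>1 (x, v) w) / (E\<^sub>1 (x, v) * E\<^sub>1 (x, v)))) (at (x, v))"
    if v: "v \<noteq> 0" for v
    unfolding f_def
    by (intro has_derivative_divide' has_derivative_mult has_fderiv P(1) E\<^sub>1(1) E\<^sub>1_nz inW xy(2) v)
  have "fderiv f (x, v) (0, e) = 0" if v: "v \<noteq> 0" for v e
  proof -
    have "(l v * l e + l e * l v) * E\<^sub>1 (x, v) - l v * l v * fderiv E\<^sub>1 (x, v) (0, e)
        = l v * (2 * l e * E\<^sub>1 (x, v) - l v * fderiv E\<^sub>1 (x, v) (0, e))"
      by (simp add: algebra_simps)
    also have "\<dots> = 0"
      by (simp add: key[OF v])
    finally show ?thesis
      by (simp add: fderiv_eq[OF f'[OF v]] P_l[OF v] DP[OF v])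
  qed
  then have f_const: "f (x, v) = f (x, y)" if "v \<noteq> 0" for v
    using fibrewise_constant[OF dim, of f x v y] f' that xy(3) by (auto simp: differentiable_def)
  \<comment> \<open>A nonzero kernel vector is a point of the punctured fibre, and there the
    constant value of \<open>f\<close> is seen to be zero.\<close>
  obtain v where v: "v \<noteq> 0" "l v = 0"
    using exists_kernel_vector[OF dim l] .
  then have "f (x, y) = 0"
    using f_const[OF v(1)] P_l[OF v(1)] by (simp add: f_def)
  then show ?thesis
    using E\<^sub>1_nz[OF inW[OF xy(2,3)]] by (simp add: f_def xy(1))
qed

section \<open>Tangent vectors in charts\<close>

lemma snd_chart_inv: "z \<in> chart_image c \<Longrightarrow> snd c (chart_inv c z) = z"
  by (simp add: chart_image_def chart_inv_def f_inv_into_f)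

lemma chart_inv_in: "z \<in> chart_image c \<Longrightarrow> chart_inv c z \<in> fst c"
  by (simp add: chart_image_def chart_inv_def inv_into_into)

text \<open>Shared by the atlas of \<open>M\<close> and the induced atlas of the slit bundle. It
  records first derivatives of transition maps, on which tangent vectors and differentials
  depend.\<close>

locale differentiable_atlas =
  fixes A :: "('p, 'e::euclidean_space) chart set"
  assumes inj_chart: "c \<in> A \<Longrightarrow> inj_on (snd c) (fst c)"
    and open_overlap: "c \<in> A \<Longrightarrow> d \<in> A \<Longrightarrow> open (snd c ` (fst c \<inter> fst d))"
    and differentiable_transition: "c \<in> A \<Longrightarrow> d \<in> A \<Longrightarrow> z \<in> snd c ` (fst c \<inter> fst d) \<Longrightarrow>
      (snd d \<circ> chart_inv c) differentiable at z"
begin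

lemma chart_inv_snd: "c \<in> A \<Longrightarrow> p \<in> fst c \<Longrightarrow> chart_inv c (snd c p) = p"
  by (simp add: chart_inv_def inj_chart)

lemma open_chart_image: "c \<in> A \<Longrightarrow> open (chart_image c)"
  using open_overlap[of c c] by (simp add: chart_image_def)

lemma charts_atD: "c \<in> charts_at A p \<Longrightarrow> c \<in> A" "c \<in> charts_at A p \<Longrightarrow> p \<in> fst c"
  by (simp_all add: charts_at_def)

lemma snd_in_chart_image: "c \<in> charts_at A p \<Longrightarrow> snd c p \<in> chart_image c"
  by (simp add: charts_at_def chart_image_def)

lemma chart_at_in: "c \<in> charts_at A p \<Longrightarrow> chart_at A p \<in> charts_at A p"
  unfolding chart_at_def by (rule someI)

lemma has_derivative_transition:
  assumes "c \<in> charts_at A p" "d \<in> charts_at A p"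
  shows "(snd d \<circ> chart_inv c has_derivative transition_deriv c d p) (at (snd c p))"
  unfolding transition_deriv_def
  by (rule has_fderiv[OF differentiable_transition]) (use assms charts_atD in auto)

lemma has_derivative_change_chart:
  fixes f :: "'p \<Rightarrow> 'b::real_normed_vector"
  assumes c: "c \<in> charts_at A p" and d: "d \<in> charts_at A p"
    and f: "(f \<circ> chart_inv d has_derivative f') (at (snd d p))"
  shows "(f \<circ> chart_inv c has_derivative (\<lambda>v. f' (transition_deriv c d p v))) (at (snd c p))"
proof -
  have 0: "(snd d \<circ> chart_inv c) (snd c p) = snd d p"
    using charts_atD[OF c] by (simp add: chart_inv_snd)
  have "((f \<circ> chart_inv d) \<circ> (snd d \<circ> chart_inv c) has_derivative f' \<circ> transition_deriv c d p)
      (at (snd c p))"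
    by (rule diff_chain_at[OF has_derivative_transition[OF c d]]) (use f 0 in simp)
  \<comment> \<open>The map \<open>chart_inv d\<close> undoes \<open>snd d\<close> only for points
    of the overlap, hence the passage to this open set.\<close>
  then have "(f \<circ> chart_inv c has_derivative f' \<circ> transition_deriv c d p) (at (snd c p))"
    by (rule has_derivative_transform_within_open[where s = "snd c ` (fst c \<inter> fst d)"])
      (use charts_atD[OF c] charts_atD[OF d] open_overlap
        in \<open>auto simp: chart_inv_snd[OF charts_atD(1)[OF c]] chart_inv_snd[OF charts_atD(1)[OF d]]\<close>)
  then show ?thesis
    by (simp add: comp_def)
qed

text \<open>The coordinate map \<open>snd e\<close> can be differentiated in the chart
  \<open>c\<close> directly or by way of \<open>d\<close>; derivatives are unique.\<close>

lemma transition_cocycle: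
  assumes c: "c \<in> charts_at A p" and d: "d \<in> charts_at A p" and e: "e \<in> charts_at A p"
  shows "transition_deriv c e p v = transition_deriv d e p (transition_deriv c d p v)"
  using has_derivative_unique[OF has_derivative_transition[OF c e]
      has_derivative_change_chart[OF c d has_derivative_transition[OF d e]]] by simp

lemma transition_self:
  assumes c: "c \<in> charts_at A p"
  shows "transition_deriv c c p v = v"
proof -
  have "fderiv (snd c \<circ> chart_inv c) (snd c p) = fderiv (\<lambda>z. z) (snd c p)"
    by (rule fderiv_cong_open[OF open_chart_image[OF charts_atD(1)[OF c]] snd_in_chart_image[OF c]])
      (simp add: snd_chart_inv)
  then show ?thesis
    by (simp add: transition_deriv_def)
qed

lemma linear_transition:
  assumes "c \<in> charts_at A p" "d \<in> charts_at A p"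
  shows "linear (transition_deriv c d p)"
  using has_derivative_transition[OF assms] by (rule has_derivative_linear)

lemma coord_vector_self: "c \<in> charts_at A p \<Longrightarrow> coord_vector A c p e c = e"
  by (simp add: coord_vector_def transition_self)

lemma tangent_spaceI:
  assumes "\<And>c d. c \<in> charts_at A p \<Longrightarrow> d \<in> charts_at A p \<Longrightarrow> v d = transition_deriv c d p (v c)"
    and "\<And>c. c \<notin> charts_at A p \<Longrightarrow> v c = 0"
  shows "v \<in> tangent_space A p"
  unfolding tangent_space_def using assms by blast

lemma tangent_space_outside: "v \<in> tangent_space A p \<Longrightarrow> c \<notin> charts_at A p \<Longrightarrow> v c = 0"
  unfolding tangent_space_def by blast

lemma coord_vector_in_tangent_space:
  assumes c: "c \<in> charts_at A p"
  shows "coord_vector A c p e \<in> tangent_space A p"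
proof (rule tangent_spaceI)
  fix d d' assume d: "d \<in> charts_at A p" and d': "d' \<in> charts_at A p"
  show "coord_vector A c p e d' = transition_deriv d d' p (coord_vector A c p e d)"
    using d d' transition_cocycle[OF c d d', of e] by (simp add: coord_vector_def)
qed (simp add: coord_vector_def)

lemma tangent_spaceD:
  assumes "v \<in> tangent_space A p" "c \<in> charts_at A p" "d \<in> charts_at A p"
  shows "v d = transition_deriv c d p (v c)"
  using assms unfolding tangent_space_def by blast

lemma tangent_vector_eqI:
  assumes v: "v \<in> tangent_space A p" and w: "w \<in> tangent_space A p"
    and c: "c \<in> charts_at A p" and eq: "v c = w c"
  shows "v = w"
proof
  fix d
  show "v d = w d"
  proof (cases "d \<in> charts_at A p")
    case True
    then show ?thesis
      by (simp add: tangent_spaceD[OF v c] tangent_spaceD[OF w c] eq)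
  next
    case False
    then show ?thesis
      using tangent_space_outside[OF v] tangent_space_outside[OF w] by simp
  qed
qed

lemma scaleR_in_tangent_space:
  assumes v: "v \<in> tangent_space A p"
  shows "(\<lambda>c. r *\<^sub>R v c) \<in> tangent_space A p"
proof (rule tangent_spaceI)
  fix c d assume c: "c \<in> charts_at A p" and d: "d \<in> charts_at A p"
  show "r *\<^sub>R v d = transition_deriv c d p (r *\<^sub>R v c)"
    unfolding linear_cmul[OF linear_transition[OF c d]] tangent_spaceD[OF v c d] ..
qed (simp add: tangent_space_outside[OF v])

lemma zero_in_tangent_space: "(\<lambda>_. 0) \<in> tangent_space A p"
  by (rule tangent_spaceI) (simp_all add: linear_0[OF linear_transition])

lemma tangent_vector_eq_zero_iff:
  assumes "v \<in> tangent_space A p" "c \<in> charts_at A p"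
  shows "v = (\<lambda>_. 0) \<longleftrightarrow> v c = 0"
  using tangent_vector_eqI[OF assms(1) zero_in_tangent_space assms(2)] by auto

text \<open>The transformation rule of \<open>v\<close> absorbs the transition derivative from the
  chain rule. The arbitrary chart in \<open>chart_at\<close> can thus be exchanged for any chart
  around \<open>p\<close>.\<close>

lemma differential_in_chart:
  assumes v: "v \<in> tangent_space A p" and c: "c \<in> charts_at A p" and f: "smooth_fun A f"
  shows "differential A f p v = fderiv (f \<circ> chart_inv c) (snd c p) (v c)"
proof -
  let ?d = "chart_at A p"
  have d: "?d \<in> charts_at A p"
    using c by (rule chart_at_in)
  have "f \<circ> chart_inv ?d differentiable at (snd ?d p)"
    using f charts_atD[OF d] snd_in_chart_image[OF d]
    by (auto simp: smooth_fun_def intro!: smooth_on_differentiable)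
  from fderiv_eq[OF has_derivative_change_chart[OF c d has_fderiv[OF this]]] show ?thesis
    by (simp add: differential_def Let_def tangent_spaceD[OF v c d])
qed

end

lemma k_times_differentiable_on_subset:
  "k_times_differentiable_on k W f \<Longrightarrow> V \<subseteq> W \<Longrightarrow> k_times_differentiable_on k V f"
proof (induction k arbitrary: f)
  case 0
  then show ?case
    by (auto intro: continuous_on_subset)
next
  case (Suc k)
  then show ?case
    unfolding k_times_differentiable_on.simps(2) by blast
qed

lemma smooth_on_subset: "smooth_on W f \<Longrightarrow> V \<subseteq> W \<Longrightarrow> smooth_on V f"
  unfolding smooth_on_def by (blast intro: k_times_differentiable_on_subset)

section \<open>The induced atlas of the slit tangent bundle\<close>

definition slit_chart ::
    "('p, 'e::euclidean_space) chart set \<Rightarrow> ('p, 'e) chart \<Rightarrow> (('p, 'e) tpoint, 'e \<times> 'e) chart" where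
  "slit_chart A c = (fst (tangent_chart A c) \<inter> slit_bundle A, snd (tangent_chart A c))"

lemma slit_atlas_eq: "slit_atlas A = slit_chart A ` A"
  by (simp add: slit_atlas_def slit_chart_def)

locale smooth_atlas =
  fixes A :: "('p, 'e::euclidean_space) chart set"
  assumes inj: "c \<in> A \<Longrightarrow> inj_on (snd c) (fst c)"
    and overlap: "c \<in> A \<Longrightarrow> d \<in> A \<Longrightarrow> open (snd c ` (fst c \<inter> fst d))"
    and smooth_transition: "c \<in> A \<Longrightarrow> d \<in> A \<Longrightarrow>
      smooth_on (snd c ` (fst c \<inter> fst d)) (snd d \<circ> chart_inv c)"

lemma smooth_manifold_imp_smooth_atlas:
  assumes M: "smooth_manifold M A"
  shows "smooth_atlas A"
proof
  fix c d assume c: "c \<in> A" and d: "d \<in> A"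
  have open_c: "openin M (fst c)" and open_d: "openin M (fst d)" and im: "open (chart_image c)"
    and homeo: "homeomorphic_map (subtopology M (fst c)) (top_of_set (chart_image c)) (snd c)"
    using M c d unfolding smooth_manifold_def by blast+
  have "topspace (subtopology M (fst c)) = fst c"
    using openin_subset[OF open_c] by auto
  then show "inj_on (snd c) (fst c)"
    using homeomorphic_imp_injective_map[OF homeo] by simp
  have "openin (subtopology M (fst c)) (fst c \<inter> fst d)"
    using open_d openin_subtopology_Int2 by blast
  then have "openin (top_of_set (chart_image c)) (snd c ` (fst c \<inter> fst d))"
    using homeomorphic_imp_open_map[OF homeo] by (simp add: open_map_def)
  then show "open (snd c ` (fst c \<inter> fst d))"
    using im openin_open_trans by blast
  show "smooth_on (snd c ` (fst c \<inter> fst d)) (snd d \<circ> chart_inv c)"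
    using M c d unfolding smooth_manifold_def by blast
qed

context smooth_atlas
begin

sublocale base: differentiable_atlas A
  using inj overlap smooth_transition smooth_on_differentiable by unfold_locales blast+

lemma slit_bundleD:
  assumes "u \<in> slit_bundle A"
  shows "snd u \<in> tangent_space A (fst u)" and "snd u \<noteq> (\<lambda>_. 0)"
  using assms by (auto simp: slit_bundle_def tangent_bundle_def)

lemma in_slit_chart_iff: "u \<in> fst (slit_chart A c) \<longleftrightarrow> u \<in> slit_bundle A \<and> fst u \<in> fst c"
  by (auto simp: slit_chart_def tangent_chart_def slit_bundle_def)

lemma snd_slit_chart: "snd (slit_chart A c) u = (snd c (fst u), snd u c)"
  by (simp add: slit_chart_def tangent_chart_def case_prod_beta)

lemma slit_bundle_component_nonzero:
  assumes "u \<in> slit_bundle A" "c \<in> A" "fst u \<in> fst c"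
  shows "snd u c \<noteq> 0"
  using base.tangent_vector_eq_zero_iff[OF slit_bundleD(1)[OF assms(1)], of c] slit_bundleD(2)[OF assms(1)]
    assms(2,3) by (simp add: charts_at_def)

lemma slit_chart_overlap_image:
  assumes c: "c \<in> A" and d: "d \<in> A"
  shows "snd (slit_chart A c) ` (fst (slit_chart A c) \<inter> fst (slit_chart A d))
    = snd c ` (fst c \<inter> fst d) \<times> (- {0})" (is "?L = ?R")
proof (intro equalityI subsetI)
  fix z assume "z \<in> ?L"
  then obtain u where u: "u \<in> slit_bundle A" "fst u \<in> fst c" "fst u \<in> fst d"
      "z = (snd c (fst u), snd u c)"
    by (auto simp: in_slit_chart_iff snd_slit_chart)
  with slit_bundle_component_nonzero[OF u(1) c u(2)] show "z \<in> ?R"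
    by auto
next
  fix z assume "z \<in> ?R"
  then obtain p y where p: "p \<in> fst c" "p \<in> fst d" and y: "y \<noteq> 0" and z: "z = (snd c p, y)"
    by auto
  \<comment> \<open>The tangent vector at \<open>p\<close> with component \<open>y\<close> in the
    chart \<open>c\<close>; it is nonzero because \<open>y\<close> is.\<close>
  let ?v = "coord_vector A c p y"
  have cp: "c \<in> charts_at A p"
    using c p by (simp add: charts_at_def)
  have "(p, ?v) \<in> slit_bundle A"
    using base.coord_vector_in_tangent_space[OF cp, of y] base.coord_vector_self[OF cp, of y] y c p
    by (auto simp: slit_bundle_def tangent_bundle_def carrier_of_def)
  then have "(p, ?v) \<in> fst (slit_chart A c) \<inter> fst (slit_chart A d)"
    using p by (simp add: in_slit_chart_iff)
  moreover have "snd (slit_chart A c) (p, ?v) = z"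
    unfolding snd_slit_chart using base.coord_vector_self[OF cp, of y] z by simp
  ultimately show "z \<in> ?L"
    by (metis image_eqI)
qed

lemma slit_chart_image:
  assumes c: "c \<in> A"
  shows "chart_image (slit_chart A c) = chart_image c \<times> (- {0})"
  using slit_chart_overlap_image[OF c c] by (simp add: chart_image_def)

lemma inj_slit_chart:
  assumes c: "c \<in> A"
  shows "inj_on (snd (slit_chart A c)) (fst (slit_chart A c))"
proof (rule inj_onI)
  fix u u' assume "u \<in> fst (slit_chart A c)" "u' \<in> fst (slit_chart A c)"
  then have u: "u \<in> slit_bundle A" "fst u \<in> fst c" and u': "u' \<in> slit_bundle A" "fst u' \<in> fst c"
    by (simp_all add: in_slit_chart_iff)
  assume "snd (slit_chart A c) u = snd (slit_chart A c) u'"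
  then have eq: "snd c (fst u) = snd c (fst u')" "snd u c = snd u' c"
    unfolding snd_slit_chart by auto
  have p: "fst u = fst u'"
    using inj_onD[OF inj[OF c] eq(1) u(2) u'(2)] .
  have "snd u = snd u'"
    using base.tangent_vector_eqI[OF slit_bundleD(1)[OF u(1)], of "snd u'" c]
      slit_bundleD(1)[OF u'(1)] eq(2) p c u(2) by (simp add: charts_at_def)
  with p show "u = u'"
    by (rule prod_eqI)
qed

lemma slit_chart_transition:
  assumes c: "c \<in> A" and d: "d \<in> A" and z: "z \<in> snd c ` (fst c \<inter> fst d) \<times> (- {0})"
  shows "(snd (slit_chart A d) \<circ> chart_inv (slit_chart A c)) z = tangent_map (snd d \<circ> chart_inv c) z"
proof -
  obtain u where u: "u \<in> fst (slit_chart A c)" "u \<in> fst (slit_chart A d)" and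
      z': "z = snd (slit_chart A c) u"
    using z unfolding slit_chart_overlap_image[OF c d, symmetric] by blast
  have ub: "u \<in> slit_bundle A" "c \<in> charts_at A (fst u)" "d \<in> charts_at A (fst u)"
    using u c d unfolding in_slit_chart_iff by (auto simp: charts_at_def)
  have "chart_inv (slit_chart A c) z = u"
    unfolding z' chart_inv_def using inj_slit_chart[OF c] u(1) by (rule inv_into_f_f)
  then have "(snd (slit_chart A d) \<circ> chart_inv (slit_chart A c)) z = (snd d (fst u), snd u d)"
    by (simp add: snd_slit_chart)
  also have "\<dots> = tangent_map (snd d \<circ> chart_inv c) z"
    using base.tangent_spaceD[OF slit_bundleD(1)[OF ub(1)] ub(2,3)] base.chart_inv_snd[OF c]
      base.charts_atD(2)[OF ub(2)]
    unfolding z' snd_slit_chart tangent_map_def by (simp add: transition_deriv_def)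
  finally show ?thesis .
qed

lemma has_derivative_slit_transition:
  assumes c: "c \<in> A" and d: "d \<in> A" and z: "z \<in> snd c ` (fst c \<inter> fst d) \<times> (- {0})"
  defines "\<tau> \<equiv> snd d \<circ> chart_inv c"
  shows "(snd (slit_chart A d) \<circ> chart_inv (slit_chart A c) has_derivative
      (\<lambda>w. (fderiv \<tau> (fst z) (fst w), fderiv2 \<tau> (fst z) (snd z) (fst w) + fderiv \<tau> (fst z) (snd w)))) (at z)"
proof (rule has_derivative_transform_within_open)
  show "(tangent_map \<tau> has_derivative
      (\<lambda>w. (fderiv \<tau> (fst z) (fst w), fderiv2 \<tau> (fst z) (snd z) (fst w) + fderiv \<tau> (fst z) (snd w)))) (at z)"
    using has_derivative_tangent_map[OF overlap[OF c d] _ smooth_transition[OF c d]] z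
    by (auto simp: \<tau>_def)
  show "open (snd c ` (fst c \<inter> fst d) \<times> (- {0 :: 'e}))"
    by (intro open_Times overlap[OF c d] open_Compl closed_singleton)
qed (use z slit_chart_transition[OF c d] in \<open>auto simp: \<tau>_def\<close>)

sublocale slit: differentiable_atlas "slit_atlas A"
proof
  fix c' d' assume "c' \<in> slit_atlas A" "d' \<in> slit_atlas A"
  then obtain c d where c: "c \<in> A" "c' = slit_chart A c" and d: "d \<in> A" "d' = slit_chart A d"
    by (auto simp: slit_atlas_eq)
  show "inj_on (snd c') (fst c')"
    using inj_slit_chart[OF c(1)] c(2) by simp
  show "open (snd c' ` (fst c' \<inter> fst d'))"
    unfolding c(2) d(2) slit_chart_overlap_image[OF c(1) d(1)]
    by (intro open_Times overlap[OF c(1) d(1)] open_Compl closed_singleton)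
  show "(snd d' \<circ> chart_inv c') differentiable at z" if "z \<in> snd c' ` (fst c' \<inter> fst d')" for z
    using that has_derivative_slit_transition[OF c(1) d(1)]
    unfolding c(2) d(2) slit_chart_overlap_image[OF c(1) d(1)] differentiable_def by blast
qed

lemma slit_charts_at:
  assumes "u \<in> slit_bundle A"
  shows "charts_at (slit_atlas A) u = slit_chart A ` charts_at A (fst u)"
  using assms by (auto simp: charts_at_def slit_atlas_eq in_slit_chart_iff)

lemma slit_chart_in:
  "c \<in> A \<Longrightarrow> u \<in> slit_bundle A \<Longrightarrow> fst u \<in> fst c \<Longrightarrow> slit_chart A c \<in> charts_at (slit_atlas A) u"
  by (simp add: charts_at_def slit_atlas_eq in_slit_chart_iff)

lemma chart_inv_slit:
  assumes "c \<in> A" "z \<in> chart_image (slit_chart A c)"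
  shows "chart_inv (slit_chart A c) z \<in> slit_bundle A"
    and "slit_chart A c \<in> charts_at (slit_atlas A) (chart_inv (slit_chart A c) z)"
  using chart_inv_in[OF assms(2)] slit_chart_in[OF assms(1)] by (simp_all add: in_slit_chart_iff)

text \<open>The derivative of a tangent map is block triangular with equal diagonal blocks
  \<open>T\<close>. This is why \<open>(0, fst w)\<close> transforms like a tangent vector, so that
  the tangent structure is well defined.\<close>

lemma slit_transition_deriv:
  assumes u: "u \<in> slit_bundle A" and c: "c \<in> charts_at (slit_atlas A) u" and d: "d \<in> charts_at (slit_atlas A) u"
  obtains T B where "linear T" "transition_deriv c d u = (\<lambda>w. (T (fst w), B (fst w) + T (snd w)))"
    "linear B"
proof -
  obtain c' d' where c': "c' \<in> charts_at A (fst u)" "c = slit_chart A c'"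
    and d': "d' \<in> charts_at A (fst u)" "d = slit_chart A d'"
    using c d slit_charts_at[OF u] by blast
  let ?\<tau> = "snd d' \<circ> chart_inv c'" and ?z = "snd c u"
  have A': "c' \<in> A" "d' \<in> A"
    using c' d' base.charts_atD by blast+
  have "?z \<in> snd c ` (fst c \<inter> fst d)"
    using slit.charts_atD(2)[OF c] slit.charts_atD(2)[OF d] by blast
  then have z: "?z \<in> snd c' ` (fst c' \<inter> fst d') \<times> (- {0})"
    unfolding c' d' slit_chart_overlap_image[OF A'] .
  then have fz: "fst ?z \<in> snd c' ` (fst c' \<inter> fst d')"
    by (simp only: mem_Times_iff)
  show thesis
  proof (rule that)
    show "linear (fderiv ?\<tau> (fst ?z))"
      using smooth_on_differentiable[OF smooth_transition[OF A'] fz]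
      by (rule linear_frechet_derivative)
    show "linear (fderiv2 ?\<tau> (fst ?z) (snd ?z))"
      using smooth_on_differentiable[OF smooth_on_fderiv[OF smooth_transition[OF A']] fz]
      by (rule linear_frechet_derivative)
    show "transition_deriv c d u = (\<lambda>w. (fderiv ?\<tau> (fst ?z) (fst w),
        fderiv2 ?\<tau> (fst ?z) (snd ?z) (fst w) + fderiv ?\<tau> (fst ?z) (snd w)))"
      using fderiv_eq[OF has_derivative_slit_transition[OF A' z]]
      unfolding transition_deriv_def c'(2) d'(2) .
  qed
qed

lemma tangent_structure_in_tangent_space:
  assumes u: "u \<in> slit_bundle A" and w: "w \<in> tangent_space (slit_atlas A) u"
  shows "tangent_structure A u w \<in> tangent_space (slit_atlas A) u"
proof (rule slit.tangent_spaceI)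
  fix c d assume c: "c \<in> charts_at (slit_atlas A) u" and d: "d \<in> charts_at (slit_atlas A) u"
  obtain T B where T: "linear T" "linear B"
    "transition_deriv c d u = (\<lambda>w. (T (fst w), B (fst w) + T (snd w)))"
    using slit_transition_deriv[OF u c d] by metis
  have "fst (w d) = T (fst (w c))"
    unfolding slit.tangent_spaceD[OF w c d] T(3) by simp
  then show "tangent_structure A u w d = transition_deriv c d u (tangent_structure A u w c)"
    using c d by (simp add: tangent_structure_def T(3) linear_0[OF T(1)] linear_0[OF T(2)])
qed (simp add: tangent_structure_def)

lemma scale_fibre_in_slit_bundle:
  assumes u: "u \<in> slit_bundle A" and r: "r > 0"
  shows "scale_fibre r u \<in> slit_bundle A"
proof -
  have "(\<lambda>c. r *\<^sub>R snd u c) \<noteq> (\<lambda>_. 0)"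
  proof
    assume "(\<lambda>c. r *\<^sub>R snd u c) = (\<lambda>_. 0)"
    then have "snd u c = 0" for c
      using r by (metis less_irrefl scaleR_eq_0_iff)
    then show False
      using slit_bundleD(2)[OF u] by (metis ext)
  qed
  then show ?thesis
    using u base.scaleR_in_tangent_space[OF slit_bundleD(1)[OF u], of r]
    by (auto simp: scale_fibre_def slit_bundle_def tangent_bundle_def)
qed

lemma chart_inv_scale_fibre:
  assumes c: "c \<in> A" and z: "z \<in> chart_image (slit_chart A c)" and r: "r > 0"
  shows "chart_inv (slit_chart A c) (fst z, r *\<^sub>R snd z) = scale_fibre r (chart_inv (slit_chart A c) z)"
proof -
  let ?u = "chart_inv (slit_chart A c) z"
  have u: "?u \<in> slit_bundle A" "fst ?u \<in> fst c"
    using chart_inv_in[OF z] by (simp_all add: in_slit_chart_iff)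
  have "snd (slit_chart A c) ?u = z"
    by (rule snd_chart_inv[OF z])
  then have "snd (slit_chart A c) (scale_fibre r ?u) = (fst z, r *\<^sub>R snd z)"
    unfolding snd_slit_chart by (simp add: scale_fibre_def prod_eq_iff)
  moreover have "scale_fibre r ?u \<in> fst (slit_chart A c)"
    unfolding in_slit_chart_iff using scale_fibre_in_slit_bundle[OF u(1) r] u(2)
    by (simp add: scale_fibre_def)
  ultimately show ?thesis
    unfolding chart_inv_def using inv_into_f_f[OF inj_slit_chart[OF c]] by metis
qed

end

section \<open>Sprays and Finsler functions in charts\<close>

text \<open>Differentiating the homogeneity relation in \<open>r\<close> at \<open>r = 1\<close>
  yields Euler's relation.\<close>

lemma fderiv_one_homogeneous:
  fixes f :: "'a::real_normed_vector \<times> 'a \<Rightarrow> real"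
  assumes f: "f differentiable at z"
    and homogeneous: "\<And>r. r > 0 \<Longrightarrow> f (fst z, r *\<^sub>R snd z) = r * f z"
  shows "fderiv f z (0, snd z) = f z"
proof -
  have p: "((\<lambda>r. (fst z, r *\<^sub>R snd z)) has_derivative (\<lambda>h. (0, h *\<^sub>R snd z))) (at 1)"
    by (intro has_derivative_Pair has_derivative_const has_derivative_scaleR_left has_derivative_ident)
  have "(f has_derivative fderiv f z) (at (fst z, 1 *\<^sub>R snd z))"
    using has_fderiv[OF f] by simp
  from has_derivative_compose[OF p this]
  have 1: "((\<lambda>r. f (fst z, r *\<^sub>R snd z)) has_derivative (\<lambda>h. fderiv f z (0, h *\<^sub>R snd z))) (at 1)" .
  have 2: "((\<lambda>r. r * f z) has_derivative (\<lambda>h. h * f z)) (at 1)"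
    by (intro has_derivative_mult_left has_derivative_ident)
  have "fderiv f z (0, 1 *\<^sub>R snd z) = 1 * f z"
    by (rule has_derivative_eq_open[where W = "{0<..}", OF _ _ _ 1 2]) (simp_all add: homogeneous)
  then show ?thesis
    by simp
qed

definition in_chart ::
    "('p, 'e::euclidean_space) chart set \<Rightarrow> ('p, 'e) chart \<Rightarrow> (('p, 'e) tpoint \<Rightarrow> 'b) \<Rightarrow> 'e \<times> 'e \<Rightarrow> 'b"
  where "in_chart A c f = f \<circ> chart_inv (slit_chart A c)"

definition field_in_chart ::
    "('p, 'e::euclidean_space) chart set \<Rightarrow> ('p, 'e) chart \<Rightarrow> (('p, 'e) tpoint \<Rightarrow> ('p, 'e) ttvec) \<Rightarrow>
     'e \<times> 'e \<Rightarrow> 'e \<times> 'e"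
  where "field_in_chart A c S z = S (chart_inv (slit_chart A c) z) (slit_chart A c)"

lemma smooth_fun_power2:
  assumes "differentiable_atlas A" "smooth_fun A f"
  shows "smooth_fun A (\<lambda>p. (f p)\<^sup>2)"
  using assms smooth_on_power2[of _ "f \<circ> chart_inv _"] differentiable_atlas.open_chart_image
  unfolding smooth_fun_def comp_def by blast

context smooth_atlas
begin

lemma open_slit_chart_image: "c \<in> A \<Longrightarrow> open (chart_image (slit_chart A c))"
  by (rule slit.open_chart_image) (simp add: slit_atlas_eq)

lemma smooth_in_chart:
  assumes "smooth_fun (slit_atlas A) f" "c \<in> A"
  shows "smooth_on (chart_image (slit_chart A c)) (in_chart A c f)"
  using assms by (simp add: smooth_fun_def slit_atlas_eq in_chart_def)

lemma carrier_slit_atlas: "carrier_of (slit_atlas A) = slit_bundle A"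
proof -
  have "\<exists>c\<in>A. u \<in> fst (slit_chart A c)" if u: "u \<in> slit_bundle A" for u
  proof -
    have "fst u \<in> carrier_of A"
      using u by (auto simp: slit_bundle_def tangent_bundle_def)
    then show ?thesis
      unfolding carrier_of_def in_slit_chart_iff using u by blast
  qed
  then show ?thesis
    by (auto simp: carrier_of_def slit_atlas_eq in_slit_chart_iff)
qed

lemma fderiv_in_chart_one_homogeneous:
  assumes f: "smooth_fun (slit_atlas A) f" "one_homogeneous_on (slit_bundle A) f"
    and c: "c \<in> A" and z: "z \<in> chart_image (slit_chart A c)"
  shows "fderiv (in_chart A c f) z (0, snd z) = in_chart A c f z"
proof (rule fderiv_one_homogeneous)
  show "in_chart A c f differentiable at z"
    using smooth_on_differentiable[OF smooth_in_chart[OF f(1) c] z] .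
  show "in_chart A c f (fst z, r *\<^sub>R snd z) = r * in_chart A c f z" if "r > 0" for r
    using f(2) chart_inv_slit(1)[OF c z] that
    by (simp add: in_chart_def chart_inv_scale_fibre[OF c z that] one_homogeneous_on_def)
qed

lemma finsler_energy_in_chart:
  fixes F
  assumes F: "finsler_function A F" and c: "c \<in> A" and z: "z \<in> chart_image (slit_chart A c)"
  defines "E \<equiv> in_chart A c (\<lambda>u. (F u)\<^sup>2)"
  shows "E z > 0" and "fderiv E z (0, snd z) = 2 * E z"
proof -
  let ?F = "in_chart A c F"
  have smooth: "smooth_fun (slit_atlas A) F"
    using F unfolding finsler_function_def by blast
  have sub: "slit_bundle A \<subseteq> tangent_bundle A"
    by (auto simp: slit_bundle_def)
  have hom: "one_homogeneous_on (slit_bundle A) F"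
    using F sub unfolding finsler_function_def one_homogeneous_on_def by blast
  have E: "E = (\<lambda>z. (?F z)\<^sup>2)"
    by (auto simp: E_def in_chart_def)
  have "?F z \<noteq> 0"
    using F chart_inv_slit(1)[OF c z] sub slit_bundleD(2)[OF chart_inv_slit(1)[OF c z]]
    unfolding finsler_function_def in_chart_def comp_def by blast
  then show "E z > 0"
    by (simp add: E)
  have "(?F has_derivative fderiv ?F z) (at z)"
    by (rule has_fderiv[OF smooth_on_differentiable[OF smooth_in_chart[OF smooth c] z]])
  from fderiv_eq[OF has_derivative_power[OF this, of 2]]
  show "fderiv E z (0, snd z) = 2 * E z"
    by (simp add: E fderiv_in_chart_one_homogeneous[OF smooth hom c z] power2_eq_square)
qed

section \<open>Geodesic sprays in a chart\<close>

lemma semispray_in_chart: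
  assumes S: "spray A S" and c: "c \<in> A"
  shows "semispray_chart (chart_image (slit_chart A c)) (field_in_chart A c S)"
proof
  show "open (chart_image (slit_chart A c))"
    by (rule open_slit_chart_image[OF c])
  show "smooth_on (chart_image (slit_chart A c)) (field_in_chart A c S)"
    using S c unfolding spray_def smooth_vector_field_def slit_atlas_eq field_in_chart_def by blast
  fix z assume z: "z \<in> chart_image (slit_chart A c)"
  let ?u = "chart_inv (slit_chart A c) z"
  have "tangent_structure A ?u (S ?u) (slit_chart A c) = liouville A ?u (slit_chart A c)"
    using S chart_inv_slit(1)[OF c z] unfolding spray_def by metis
  then show "fst (field_in_chart A c S z) = snd z"
    using chart_inv_slit(2)[OF c z] snd_chart_inv[OF z]
    by (simp add: tangent_structure_def liouville_def field_in_chart_def)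
qed

text \<open>In the chart, \<open>d\<^sub>J f\<close> has the coefficients \<partial>E/\<partial>y.
  The formula is given in the chart selected by \<open>chart_at\<close>, where the exterior
  derivative is computed by definition.\<close>

lemma ddJ_in_chart:
  assumes f: "smooth_fun (slit_atlas A) f" and u: "u \<in> slit_bundle A"
    and d: "d \<in> A" "chart_at (slit_atlas A) u = slit_chart A d" "fst u \<in> fst d"
  defines "E \<equiv> in_chart A d f" and "z \<equiv> snd (slit_chart A d) u"
  shows "ddJ A f u v w = fderiv2 E z (0, fst (w (slit_chart A d))) (v (slit_chart A d))
    - fderiv2 E z (0, fst (v (slit_chart A d))) (w (slit_chart A d))"
proof -
  let ?d = "slit_chart A d" and ?A = "slit_atlas A"
  let ?inv = "chart_inv ?d"
  have \<theta>: "differential_along ?A (tangent_structure A) f (?inv x) (coord_vector ?A ?d (?inv x) e)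
      = fderiv E x (0, fst e)" if x: "x \<in> chart_image ?d" for x e
  proof -
    note u' = chart_inv_slit[OF d(1) x]
    have "tangent_structure A (?inv x) (coord_vector ?A ?d (?inv x) e) ?d = (0, fst e)"
      using u'(2) by (simp add: tangent_structure_def slit.coord_vector_self)
    then show ?thesis
      using slit.differential_in_chart[OF tangent_structure_in_tangent_space
          [OF u'(1) slit.coord_vector_in_tangent_space[OF u'(2), of e]] u'(2) f] snd_chart_inv[OF x]
      by (simp add: differential_along_def E_def in_chart_def)
  qed
  have z: "z \<in> chart_image ?d"
    using slit.snd_in_chart_image[OF slit_chart_in[OF d(1) u d(3)]] by (simp add: z_def)
  have "fderiv (\<lambda>x. differential_along ?A (tangent_structure A) f (?inv x)
      (coord_vector ?A ?d (?inv x) e)) z = fderiv2 E z (0, fst e)" for e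
    by (rule fderiv_cong_open[OF open_slit_chart_image[OF d(1)] z \<theta>])
  then show ?thesis
    by (simp add: ddJ_def ext_deriv_one_form_def Let_def d(2) z_def)
qed

text \<open>At each point the geodesic equation is first evaluated in the chart \<open>d\<close>
  selected by \<open>chart_at\<close>, which may change from point to point. Its consequences, the
  Euler-Lagrange equations and the conservation of energy, are then moved to the fixed chart
  \<open>c\<close>.\<close>

lemma geodesic_spray_in_chart:
  assumes F: "finsler_function A F" and S: "geodesic_spray A F S" and c: "c \<in> A"
  shows "finsler_chart (chart_image (slit_chart A c)) (field_in_chart A c S)
    (in_chart A c (\<lambda>u. (F u)\<^sup>2))"
proof -
  let ?c = "slit_chart A c" and ?f = "\<lambda>u. (F u)\<^sup>2"
  have spray: "spray A S"
    using S by (simp add: geodesic_spray_def)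
  interpret semispray_chart "chart_image ?c" "field_in_chart A c S"
    by (rule semispray_in_chart[OF spray c])
  have f: "smooth_fun (slit_atlas A) ?f"
    using F smooth_fun_power2[OF slit.differentiable_atlas_axioms] unfolding finsler_function_def by blast
  have "(\<forall>e. fderiv2 (in_chart A c ?f) z (0, e) (field_in_chart A c S z)
        = fderiv (in_chart A c ?f) z (e, 0)) \<and>
      fderiv (in_chart A c ?f) z (field_in_chart A c S z) = 0" if z: "z \<in> chart_image ?c" for z
  proof -
    let ?u = "chart_inv ?c z"
    note u = chart_inv_slit[OF c z]
    obtain d where d: "d \<in> A" "chart_at (slit_atlas A) ?u = slit_chart A d" "fst ?u \<in> fst d"
      using slit.chart_at_in[OF u(2), unfolded slit_charts_at[OF u(1)]] base.charts_atD by blast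
    let ?d = "slit_chart A d" and ?E = "in_chart A d ?f" and ?z = "snd (slit_chart A d) ?u"
    have ud: "?d \<in> charts_at (slit_atlas A) ?u"
      by (rule slit_chart_in[OF d(1) u(1) d(3)])
    have zd: "?z \<in> chart_image ?d"
      by (rule slit.snd_in_chart_image[OF ud])
    have inv_d: "chart_inv ?d ?z = ?u"
      by (rule slit.chart_inv_snd[OF slit.charts_atD[OF ud]])
    have Su: "S ?u \<in> tangent_space (slit_atlas A) ?u"
      using spray u(1) by (simp add: spray_def smooth_vector_field_def carrier_slit_atlas)
    have geodesic: "fderiv2 ?E ?z (0, fst w) (S ?u ?d) - fderiv2 ?E ?z (0, fst (S ?u ?d)) w
        = - fderiv ?E ?z w" for w
    proof -
      \<comment> \<open>Any components in \<open>d\<close> belong to some tangent vector, so the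
        geodesic equation can be tested in every coordinate direction.\<close>
      let ?w = "coord_vector (slit_atlas A) ?d ?u w"
      have w: "?w \<in> tangent_space (slit_atlas A) ?u" "?w ?d = w"
        using slit.coord_vector_in_tangent_space[OF ud] slit.coord_vector_self[OF ud] by auto
      have "ddJ A ?f ?u (S ?u) ?w = - differential (slit_atlas A) ?f ?u ?w"
        using S u(1) w(1) unfolding geodesic_spray_def by blast
      then show ?thesis
        using slit.differential_in_chart[OF w(1) ud f] w(2)
        by (simp add: ddJ_in_chart[OF f u(1) d] in_chart_def)
    qed
    have Sz: "fst (S ?u ?d) = snd ?z"
      using semispray_chart.semispray[OF semispray_in_chart[OF spray d(1)] zd]
      by (simp add: field_in_chart_def inv_d)
    note EL = euler_lagrange_at_point[OF open_slit_chart_image[OF d(1)] zd smooth_in_chart[OF f d(1)]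
        finsler_energy_in_chart(2)[OF F d(1)] Sz geodesic]
    \<comment> \<open>A differential applied to a vector has the same value in all charts, so
      conservation of energy passes from \<open>d\<close> to \<open>c\<close> directly.\<close>
    have energy: "fderiv (in_chart A c ?f) z (field_in_chart A c S z) = 0"
      using slit.differential_in_chart[OF Su u(2) f] slit.differential_in_chart[OF Su ud f] EL(1)
        snd_chart_inv[OF z] by (simp add: in_chart_def field_in_chart_def)
    let ?\<tau> = "snd d \<circ> chart_inv c" and ?O = "snd c ` (fst c \<inter> fst d)"
    let ?W = "?O \<times> (- {0 :: 'e})"
    have W: "?W = snd ?c ` (fst ?c \<inter> fst ?d)"
      by (rule slit_chart_overlap_image[OF c d(1), symmetric])
    have open_W: "open ?W"
      by (intro open_Times overlap[OF c d(1)] open_Compl closed_singleton)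
    have u_both: "?u \<in> fst ?c \<inter> fst ?d"
      using slit.charts_atD(2)[OF u(2)] slit.charts_atD(2)[OF ud] by blast
    have zW: "z \<in> ?W"
      unfolding W using u_both snd_chart_inv[OF z] by (metis image_eqI)
    have sub: "?W \<subseteq> chart_image ?c"
      unfolding W chart_image_def by blast
    have trans: "(snd ?d \<circ> chart_inv ?c) x = tangent_map ?\<tau> x" if "x \<in> ?W" for x
      by (rule slit_chart_transition[OF c d(1) that])
    have inv_c: "chart_inv ?c x \<in> fst ?d" if x: "x \<in> ?W" for x
    proof -
      obtain u' where u': "u' \<in> fst ?c" "u' \<in> fst ?d" "x = snd ?c u'"
        using x unfolding W by blast
      then show ?thesis
        using slit.chart_inv_snd[OF slit.charts_atD(1)[OF u(2)]] by simp
    qed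
    \<comment> \<open>The two sides of the Euler-Lagrange equation are not tensorial separately and
      are carried along the coordinate change together.\<close>
    have "fderiv2 (in_chart A c ?f) z (0, e) (field_in_chart A c S z)
        = fderiv (in_chart A c ?f) z (e, 0)" for e
    proof (rule euler_lagrange_change_chart[OF overlap[OF c d(1)] smooth_transition[OF c d(1)] open_W zW _
          open_slit_chart_image[OF d(1)] _ smooth_on_subset[OF smooth_in_chart[OF f c] sub]
          smooth_in_chart[OF f d(1)]])
      show "fst ` ?W \<subseteq> ?O"
        by auto
      show "tangent_map ?\<tau> ` ?W \<subseteq> chart_image ?d"
      proof (rule image_subsetI)
        fix x assume x: "x \<in> ?W"
        have "(snd ?d \<circ> chart_inv ?c) x \<in> chart_image ?d"
          unfolding chart_image_def comp_def using inv_c[OF x] by (rule imageI)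
        then show "tangent_map ?\<tau> x \<in> chart_image ?d"
          by (simp only: trans[OF x])
      qed
      show "in_chart A c ?f x = in_chart A d ?f (tangent_map ?\<tau> x)" if x: "x \<in> ?W" for x
        using slit.chart_inv_snd[OF slit.charts_atD(1)[OF ud] inv_c[OF x]]
        by (simp add: trans[OF x, symmetric] in_chart_def)
      show "fst (field_in_chart A c S z) = snd z"
        by (rule semispray[OF z])
      have \<tau>z: "tangent_map ?\<tau> z = ?z"
        using trans[OF zW] by simp
      have "fderiv (snd ?d \<circ> chart_inv ?c) z = fderiv (tangent_map ?\<tau>) z"
        by (rule fderiv_cong_open[OF open_W zW trans])
      then show "S ?u ?d = fderiv (tangent_map ?\<tau>) z (field_in_chart A c S z)"
        using slit.tangent_spaceD[OF Su u(2) ud] snd_chart_inv[OF z]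
        by (simp add: transition_deriv_def field_in_chart_def)
      show "fderiv2 (in_chart A d ?f) (tangent_map ?\<tau> z) (0, e) (S ?u ?d)
          = fderiv (in_chart A d ?f) (tangent_map ?\<tau> z) (e, 0)" for e
        unfolding \<tau>z by (rule EL(2))
    qed
    with energy show ?thesis
      by blast
  qed
  then show ?thesis
    by unfold_locales (use smooth_in_chart[OF f c] in auto)
qed

section \<open>Horizontal projector and Jacobi endomorphism in a chart\<close>

lemma horizontal_projector_in_chart:
  assumes S: "spray A S" and c: "c \<in> A" and z: "z \<in> chart_image (slit_chart A c)"
  shows "horizontal_projector A S (chart_inv (slit_chart A c) z) w (slit_chart A c)
    = hlift (field_in_chart A c S) z (fst (w (slit_chart A c)))"
proof -
  let ?c = "slit_chart A c" and ?s = "field_in_chart A c S" and ?A = "slit_atlas A"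
  let ?u = "chart_inv ?c z" and ?w = "w (slit_chart A c)"
  let ?Y = "\<lambda>q. coord_vector ?A ?c q ?w"
  interpret semispray_chart "chart_image ?c" ?s
    by (rule semispray_in_chart[OF S c])
  note uc = chart_inv_slit(2)[OF c z]
  have Y: "?Y (chart_inv ?c x) ?c = ?w" if "x \<in> chart_image ?c" for x
    using slit.coord_vector_self[OF chart_inv_slit(2)[OF c that]] .
  have J: "tangent_structure A (chart_inv ?c x) (?Y (chart_inv ?c x)) ?c = (0, fst ?w)"
    if "x \<in> chart_image ?c" for x
    using chart_inv_slit(2)[OF c that] by (simp add: tangent_structure_def Y[OF that])
  have DJ: "fderiv (\<lambda>x. tangent_structure A (chart_inv ?c x) (?Y (chart_inv ?c x)) ?c) z = (\<lambda>_. 0)"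
    using fderiv_cong_open[OF open_W z J] by simp
  have DY: "fderiv (\<lambda>x. ?Y (chart_inv ?c x) ?c) z = (\<lambda>_. 0)"
    using fderiv_cong_open[OF open_W z Y] by simp
  \<comment> \<open>The extension \<open>?Y\<close> and its image under the tangent structure have
    constant components, so both brackets reduce to derivatives of \<open>?s\<close>. The last term
    is \<open>(0, snd ?w)\<close> and cancels the vertical part of \<open>w\<close> in the
    projector.\<close>
  have L: "lie_derivative_endo ?A S (tangent_structure A) ?u w ?c =
      - fderiv ?s z (0, fst ?w) - (0, fst (- fderiv ?s z ?w))"
    using uc J[OF z] Y[OF z] DJ DY snd_chart_inv[OF z]
    by (simp add: lie_derivative_endo_def lie_bracket_def Let_def field_in_chart_def[abs_def]
        tangent_structure_def)
  show ?thesis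
    by (simp add: horizontal_projector_def L hlift_def prod_eq_iff fst_fderiv_semispray[OF z])
qed

text \<open>For a constant extension \<open>Y\<close> of \<open>w\<close>, the field
  \<open>h Y\<close> has the varying components \<open>hlift s x a\<close>, and its bracket with
  \<open>S\<close> gives the first two terms of \<open>X\<close>. The third term is
  \<open>- h [S, Y]\<close>, as \<open>[S, Y]\<close> has base component \<open>- b\<close>.\<close>

lemma jacobi_endomorphism_in_chart:
  fixes w
  assumes S: "spray A S" and c: "c \<in> A" and z: "z \<in> chart_image (slit_chart A c)"
  defines "s \<equiv> field_in_chart A c S" and "a \<equiv> fst (w (slit_chart A c))" and "b \<equiv> snd (w (slit_chart A c))"
  defines "X \<equiv> fderiv (\<lambda>x. hlift s x a) z (s z) - fderiv s z (hlift s z a) + hlift s z b"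
  shows "jacobi_endomorphism A S (chart_inv (slit_chart A c) z) w (slit_chart A c)
    = X - hlift s z (fst X)"
proof -
  let ?c = "slit_chart A c" and ?A = "slit_atlas A" and ?h = "horizontal_projector A S"
  let ?u = "chart_inv ?c z" and ?w = "w (slit_chart A c)"
  let ?Y = "\<lambda>q. coord_vector ?A ?c q ?w"
  interpret semispray_chart "chart_image ?c" s
    unfolding s_def by (rule semispray_in_chart[OF S c])
  note uc = chart_inv_slit(2)[OF c z]
  have Y: "?Y (chart_inv ?c x) ?c = ?w" if "x \<in> chart_image ?c" for x
    using slit.coord_vector_self[OF chart_inv_slit(2)[OF c that]] .
  have H: "?h (chart_inv ?c x) (?Y (chart_inv ?c x)) ?c = hlift s x a"
    if "x \<in> chart_image ?c" for x
    using horizontal_projector_in_chart[OF S c that] Y[OF that] by (simp add: s_def a_def)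
  have DH: "fderiv (\<lambda>x. ?h (chart_inv ?c x) (?Y (chart_inv ?c x)) ?c) z = fderiv (\<lambda>x. hlift s x a) z"
    by (rule fderiv_cong_open[OF open_W z H])
  have DY: "fderiv (\<lambda>x. ?Y (chart_inv ?c x) ?c) z = (\<lambda>_. 0)"
    using fderiv_cong_open[OF open_W z Y] by simp
  have br: "lie_bracket ?A S ?Y ?u ?c = - fderiv s z ?w"
    using uc Y[OF z] DY snd_chart_inv[OF z]
    by (simp add: lie_bracket_def s_def field_in_chart_def[abs_def])
  have h_br: "?h ?u (lie_bracket ?A S ?Y ?u) ?c = - hlift s z b"
    using horizontal_projector_in_chart[OF S c z] fst_fderiv_semispray[OF z] hlift_minus[OF z]
    by (simp add: br b_def flip: s_def)
  have br_h: "lie_bracket ?A S (\<lambda>q. ?h q (?Y q)) ?u ?c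
      = fderiv (\<lambda>x. hlift s x a) z (s z) - fderiv s z (hlift s z a)"
    using uc DH H[OF z] snd_chart_inv[OF z]
    by (simp add: lie_bracket_def s_def field_in_chart_def[abs_def])
  have "lie_derivative_endo ?A S ?h ?u w ?c = X"
    using uc h_br br_h by (simp add: lie_derivative_endo_def Let_def X_def)
  then show ?thesis
    using horizontal_projector_in_chart[OF S c z] by (simp add: jacobi_endomorphism_def Let_def s_def)
qed

text \<open>The image of the Jacobi endomorphism annihilates \<open>E\<close>. On
  \<open>(e, 0)\<close> this image is \<open>r (0, e) - \<beta> (0, y)\<close>, and Euler's relation
  turns the second term into a multiple of \<open>E\<close>. As \<open>r\<close> and
  \<open>\<beta>\<close> are arbitrary, the data of one spray can be inserted for another with the
  same endomorphism.\<close>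

lemma isotropic_finsler_relation:
  assumes F: "finsler_function A F" and S: "geodesic_spray A F S"
    and c: "c \<in> A" and z: "z \<in> chart_image (slit_chart A c)"
    and iso: "\<And>w. w \<in> tangent_space (slit_atlas A) (chart_inv (slit_chart A c) z) \<Longrightarrow>
      jacobi_endomorphism A S (chart_inv (slit_chart A c) z) w =
        (\<lambda>d. r *\<^sub>R tangent_structure A (chart_inv (slit_chart A c) z) w d
          - \<beta> w *\<^sub>R liouville A (chart_inv (slit_chart A c) z) d)"
  defines "E \<equiv> in_chart A c (\<lambda>u. (F u)\<^sup>2)"
  shows "r * fderiv E z (0, e) =
    2 * E z * \<beta> (coord_vector (slit_atlas A) (slit_chart A c) (chart_inv (slit_chart A c) z) (e, 0))"
proof -
  let ?c = "slit_chart A c"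
  let ?u = "chart_inv ?c z"
  let ?w = "coord_vector (slit_atlas A) ?c ?u (e, 0)"
  interpret finsler_chart "chart_image ?c" "field_in_chart A c S" E
    unfolding E_def by (rule geodesic_spray_in_chart[OF F S c])
  note u = chart_inv_slit[OF c z]
  have w: "?w \<in> tangent_space (slit_atlas A) ?u" "?w ?c = (e, 0)"
    using slit.coord_vector_in_tangent_space[OF u(2)] slit.coord_vector_self[OF u(2)] by auto
  have spray: "spray A S"
    using S by (simp add: geodesic_spray_def)
  have "fderiv E z (jacobi_endomorphism A S ?u ?w ?c) = 0"
    unfolding jacobi_endomorphism_in_chart[OF spray c z] by (rule fderiv_jacobi[OF z])
  moreover have "jacobi_endomorphism A S ?u ?w ?c = r *\<^sub>R (0, e) - \<beta> ?w *\<^sub>R (0, snd z)"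
    using u(2) w(2) snd_chart_inv[OF z]
    by (simp add: iso[OF w(1)] tangent_structure_def liouville_def)
  ultimately have "r * fderiv E z (0, e) - \<beta> ?w * fderiv E z (0, snd z) = 0"
    by (simp only: fderiv_linear[OF differentiable_E[OF z]] real_scaleR_def)
  then show ?thesis
    using finsler_energy_in_chart(2)[OF F c z] by (simp add: E_def mult.commute)
qed

end

section \<open>Comparison of two metrizable sprays\<close>

theorem corollary3p2:
  fixes M :: "'p topology"
    and A :: "('p, real ^ 'n) chart set"
    and S\<^sub>0 S\<^sub>1 S\<^sub>2 :: "('p, real ^ 'n) tpoint \<Rightarrow> ('p, real ^ 'n) ttvec"
    and \<rho> :: "('p, real ^ 'n) tpoint \<Rightarrow> real"
    and \<alpha> :: "('p, real ^ 'n) tpoint \<Rightarrow> ('p, real ^ 'n) ttvec \<Rightarrow> real"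
  assumes "smooth_manifold M A" and "connected_space M" and "CARD('n) \<ge> 2"
    and "isotropic_spray A S\<^sub>0 \<rho> \<alpha>"
    and "\<forall>u\<in>slit_bundle A. \<rho> u \<noteq> 0"
    and "S\<^sub>1 \<in> projective_class A S\<^sub>0" and "finsler_metrizable A S\<^sub>1"
    and "\<forall>u\<in>slit_bundle A. \<forall>w\<in>tangent_space (slit_atlas A) u.
           jacobi_endomorphism A S\<^sub>1 u w = jacobi_endomorphism A S\<^sub>0 u w"
    and "S\<^sub>2 \<in> projective_class A S\<^sub>0" and "finsler_metrizable A S\<^sub>2"
    and "\<forall>u\<in>slit_bundle A. \<forall>w\<in>tangent_space (slit_atlas A) u.
           jacobi_endomorphism A S\<^sub>2 u w = jacobi_endomorphism A S\<^sub>0 u w"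
  shows "\<forall>u\<in>slit_bundle A. S\<^sub>1 u = S\<^sub>2 u"
proof
  fix u assume u: "u \<in> slit_bundle A"
  interpret smooth_atlas A
    using assms(1) by (rule smooth_manifold_imp_smooth_atlas)
  obtain c where c: "c \<in> A" "fst u \<in> fst c"
    using u by (auto simp: slit_bundle_def tangent_bundle_def carrier_of_def)
  let ?c = "slit_chart A c"
  let ?W = "chart_image ?c" and ?z = "snd ?c u"
  obtain F\<^sub>1 where F\<^sub>1: "finsler_function A F\<^sub>1" "geodesic_spray A F\<^sub>1 S\<^sub>1"
    using assms(7) unfolding finsler_metrizable_def by blast
  obtain F\<^sub>2 where F\<^sub>2: "finsler_function A F\<^sub>2" "geodesic_spray A F\<^sub>2 S\<^sub>2"
    using assms(10) unfolding finsler_metrizable_def by blast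
  obtain P\<^sub>1 where P\<^sub>1: "smooth_fun (slit_atlas A) P\<^sub>1" "one_homogeneous_on (slit_bundle A) P\<^sub>1"
      "\<And>u. u \<in> slit_bundle A \<Longrightarrow> S\<^sub>1 u = (\<lambda>c. S\<^sub>0 u c - (2 * P\<^sub>1 u) *\<^sub>R liouville A u c)"
    using assms(6) unfolding projective_class_def by blast
  obtain P\<^sub>2 where P\<^sub>2: "smooth_fun (slit_atlas A) P\<^sub>2" "one_homogeneous_on (slit_bundle A) P\<^sub>2"
      "\<And>u. u \<in> slit_bundle A \<Longrightarrow> S\<^sub>2 u = (\<lambda>c. S\<^sub>0 u c - (2 * P\<^sub>2 u) *\<^sub>R liouville A u c)"
    using assms(9) unfolding projective_class_def by blast
  define E\<^sub>1 where "E\<^sub>1 = in_chart A c (\<lambda>u. (F\<^sub>1 u)\<^sup>2)"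
  define E\<^sub>2 where "E\<^sub>2 = in_chart A c (\<lambda>u. (F\<^sub>2 u)\<^sup>2)"
  \<comment> \<open>With this sign \<open>S\<^sub>2 = S\<^sub>1 - 2 P C\<close>, since
    \<open>S\<^sub>0\<close> cancels.\<close>
  define P where "P z = in_chart A c P\<^sub>2 z - in_chart A c P\<^sub>1 z" for z
  interpret I1: finsler_chart ?W "field_in_chart A c S\<^sub>1" E\<^sub>1
    unfolding E\<^sub>1_def by (rule geodesic_spray_in_chart[OF F\<^sub>1 c(1)])
  interpret I2: finsler_chart ?W "field_in_chart A c S\<^sub>2" E\<^sub>2
    unfolding E\<^sub>2_def by (rule geodesic_spray_in_chart[OF F\<^sub>2 c(1)])
  have iso\<^sub>0: "jacobi_endomorphism A S\<^sub>0 v w =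
      (\<lambda>d. \<rho> v *\<^sub>R tangent_structure A v w d - \<alpha> v w *\<^sub>R liouville A v d)"
    if "v \<in> slit_bundle A" "w \<in> tangent_space (slit_atlas A) v" for v w
    using assms(4) that unfolding isotropic_spray_def by blast
  have P': "(P has_derivative (\<lambda>w. fderiv (in_chart A c P\<^sub>2) z w - fderiv (in_chart A c P\<^sub>1) z w)) (at z)"
    if "z \<in> ?W" for z
    unfolding P_def using that smooth_in_chart[OF P\<^sub>1(1) c(1)] smooth_in_chart[OF P\<^sub>2(1) c(1)]
    by (intro has_derivative_diff has_fderiv) (auto intro: smooth_on_differentiable)
  \<comment> \<open>Both sprays share \<open>\<rho>\<close> and \<open>\<alpha>\<close>. Eliminating
    \<open>\<alpha>\<close> from the two relations leaves a common factor \<open>\<rho>\<close>,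
    which cancels because the Ricci scalar does not vanish.\<close>
  have dJ: "fderiv E\<^sub>1 z (0, e) * E\<^sub>2 z = fderiv E\<^sub>2 z (0, e) * E\<^sub>1 z" if z: "z \<in> ?W" for z e
  proof -
    let ?v = "chart_inv ?c z"
    let ?a = "\<alpha> ?v (coord_vector (slit_atlas A) ?c ?v (e, 0))"
    note v = chart_inv_slit(1)[OF c(1) z]
    have 1: "\<rho> ?v * fderiv E\<^sub>1 z (0, e) = 2 * E\<^sub>1 z * ?a"
      unfolding E\<^sub>1_def
      by (rule isotropic_finsler_relation[OF F\<^sub>1 c(1) z]) (use assms(8) iso\<^sub>0 v in simp)
    have 2: "\<rho> ?v * fderiv E\<^sub>2 z (0, e) = 2 * E\<^sub>2 z * ?a"
      unfolding E\<^sub>2_def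
      by (rule isotropic_finsler_relation[OF F\<^sub>2 c(1) z]) (use assms(11) iso\<^sub>0 v in simp)
    have "\<rho> ?v * (fderiv E\<^sub>1 z (0, e) * E\<^sub>2 z) = (\<rho> ?v * fderiv E\<^sub>1 z (0, e)) * E\<^sub>2 z"
      by simp
    also have "\<dots> = (\<rho> ?v * fderiv E\<^sub>2 z (0, e)) * E\<^sub>1 z"
      unfolding 1 2 by simp
    finally have "\<rho> ?v * (fderiv E\<^sub>1 z (0, e) * E\<^sub>2 z) = \<rho> ?v * (fderiv E\<^sub>2 z (0, e) * E\<^sub>1 z)"
      by simp
    then show ?thesis
      using assms(5) v by simp
  qed
  have "P ?z = 0"
  proof (rule projective_factor_zero[where U = "chart_image c" and W = ?W])
    show "DIM(real ^ 'n) \<ge> 2"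
      using assms(3) by simp
    show "open (chart_image c)"
      by (rule base.open_chart_image[OF c(1)])
    show "?W = chart_image c \<times> (- {0})"
      by (rule slit_chart_image[OF c(1)])
    show "?z \<in> ?W"
      by (rule slit.snd_in_chart_image[OF slit_chart_in[OF c(1) u c(2)]])
  next
    fix z e assume z: "z \<in> ?W"
    show "E\<^sub>1 differentiable at z" "E\<^sub>2 differentiable at z" "field_in_chart A c S\<^sub>1 differentiable at z"
      by (rule I1.differentiable_E[OF z] I2.differentiable_E[OF z] I1.differentiable_s[OF z])+
    show "E\<^sub>1 z > 0" "fderiv E\<^sub>1 z (0, snd z) = 2 * E\<^sub>1 z"
      unfolding E\<^sub>1_def by (rule finsler_energy_in_chart[OF F\<^sub>1(1) c(1) z])+
    show "E\<^sub>2 z > 0"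
      unfolding E\<^sub>2_def by (rule finsler_energy_in_chart[OF F\<^sub>2(1) c(1) z])
    show "P differentiable at z"
      using P'[OF z] by (auto simp: differentiable_def)
    show "fderiv P z (0, snd z) = P z"
      by (simp add: fderiv_eq[OF P'[OF z]] fderiv_in_chart_one_homogeneous[OF P\<^sub>1(1,2) c(1) z]
          fderiv_in_chart_one_homogeneous[OF P\<^sub>2(1,2) c(1) z] P_def)
    show "field_in_chart A c S\<^sub>2 z = field_in_chart A c S\<^sub>1 z - (2 * P z) *\<^sub>R (0, snd z)"
      using chart_inv_slit[OF c(1) z] snd_chart_inv[OF z]
      by (simp add: field_in_chart_def P\<^sub>1(3) P\<^sub>2(3) liouville_def P_def in_chart_def algebra_simps)
    show "fderiv E\<^sub>1 z (0, e) * E\<^sub>2 z = fderiv E\<^sub>2 z (0, e) * E\<^sub>1 z"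
      by (rule dJ[OF z])
    show "fderiv E\<^sub>1 z (hlift (field_in_chart A c S\<^sub>1) z e) = 0"
      "fderiv E\<^sub>2 z (hlift (field_in_chart A c S\<^sub>2) z e) = 0"
      by (rule I1.fderiv_hlift[OF z] I2.fderiv_hlift[OF z])+
  qed
  moreover have "chart_inv ?c ?z = u"
    using slit.chart_inv_snd[OF slit.charts_atD[OF slit_chart_in[OF c(1) u c(2)]]] .
  ultimately have "P\<^sub>1 u = P\<^sub>2 u"
    by (simp add: P_def in_chart_def)
  then show "S\<^sub>1 u = S\<^sub>2 u"
    by (simp add: P\<^sub>1(3)[OF u] P\<^sub>2(3)[OF u])
qed

end
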